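(* Let $K$ be a field of characteristic zero, $L$ a finite extension of $K$, and $\{a_n\}_{n\ge 0}$ a rational sequence with coefficients in $L$. Then: (1) The sequence $\{\deg(a_n)\}_{n\ge 0}$, where $\deg(a_n)=[K(a_n):K]$, is virtually periodic. (2) Let $P_n(T)$ denote the minimal polynomial of $a_n$ over $K$. Then the sequence $\{P_n(T)\}_{n\ge0}$ is a rational sequence, that is, its generating function $\sum_{n\ge0}P_n(T)x^n$ is a rational function in $x$, with poles algebraic over $K$.
   Context: A sequence $\{a_n\}_{n\ge0}$ in a field is a rational sequence if its generating function $\sum_n a_n x^n$ is a rational function of $x$. A sequence $\{b_n\}_{n\ge0}$ is virtually periodic if there exist $N,r\in\mathbb{N}$, $r>0$, such that $b_{n+r}=b_n$ for all $n>N$. *)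

theory Defs
  imports "HOL-Algebra.Algebraic_Closure_Type"
begin

text \<open>
  A field extension \<open>L / K\<close> is given by a homomorphism \<open>\<iota>\<close> from the field (type) \<open>'k\<close>
  to the field (type) \<open>'l\<close>, which makes \<open>'l\<close> a vector space over \<open>'k\<close>.
\<close>

definition field_embedding :: "('k::field \<Rightarrow> 'l::field) \<Rightarrow> bool" where
  "field_embedding \<iota> \<longleftrightarrow>
     \<iota> 1 = 1 \<and> (\<forall>x y. \<iota> (x + y) = \<iota> x + \<iota> y) \<and> (\<forall>x y. \<iota> (x * y) = \<iota> x * \<iota> y)"

definition ext_scale :: "('k::field \<Rightarrow> 'l::field) \<Rightarrow> 'k \<Rightarrow> 'l \<Rightarrow> 'l" where
  "ext_scale \<iota> c x = \<iota> c * x"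

definition finite_extension :: "('k::field \<Rightarrow> 'l::field) \<Rightarrow> bool" where
  "finite_extension \<iota> \<longleftrightarrow>
     field_embedding \<iota> \<and> (\<exists>B. finite B \<and> module.span (ext_scale \<iota>) B = UNIV)"

definition is_subfield :: "'l::field set \<Rightarrow> bool" where
  "is_subfield S \<longleftrightarrow> 0 \<in> S \<and> 1 \<in> S \<and>
     (\<forall>x\<in>S. \<forall>y\<in>S. x + y \<in> S \<and> x * y \<in> S) \<and> (\<forall>x\<in>S. - x \<in> S \<and> inverse x \<in> S)"

definition adjoin :: "('k::field \<Rightarrow> 'l::field) \<Rightarrow> 'l \<Rightarrow> 'l set" where
  "adjoin \<iota> a = \<Inter> {S. is_subfield S \<and> range \<iota> \<subseteq> S \<and> a \<in> S}"

definition ext_degree :: "('k::field \<Rightarrow> 'l::field) \<Rightarrow> 'l \<Rightarrow> nat" where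
  "ext_degree \<iota> a = vector_space.dim (ext_scale \<iota>) (adjoin \<iota> a)"

definition algebraic_over :: "('k::field \<Rightarrow> 'l::field) \<Rightarrow> 'l \<Rightarrow> bool" where
  "algebraic_over \<iota> a \<longleftrightarrow> (\<exists>p. p \<noteq> 0 \<and> poly (map_poly \<iota> p) a = 0)"

text \<open>Only meaningful when \<open>a\<close> is algebraic over \<open>'k\<close>.\<close>

definition min_poly :: "('k::field \<Rightarrow> 'l::field) \<Rightarrow> 'l \<Rightarrow> 'k poly" where
  "min_poly \<iota> a = (THE p. lead_coeff p = 1 \<and> poly (map_poly \<iota> p) a = 0 \<and>
     (\<forall>q. q \<noteq> 0 \<and> poly (map_poly \<iota> q) a = 0 \<longrightarrow> degree p \<le> degree q))"

text \<open>
  The generating function is compared with \<open>p / q\<close> in the field of formal Laurent series,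
  where the quotient of two polynomials is always the true quotient (division of formal power
  series truncates).
\<close>

definition gen_fun_eq :: "(nat \<Rightarrow> 'a::field) \<Rightarrow> 'a poly \<Rightarrow> 'a poly \<Rightarrow> bool" where
  "gen_fun_eq a p q \<longleftrightarrow> q \<noteq> 0 \<and>
     fps_to_fls (Abs_fps a) = fps_to_fls (fps_of_poly p) / fps_to_fls (fps_of_poly q)"

definition rational_seq :: "(nat \<Rightarrow> 'a::field) \<Rightarrow> bool" where
  "rational_seq a \<longleftrightarrow> (\<exists>p q. gen_fun_eq a p q)"

text \<open>Poles of a rational generating function: zeros of the denominator in lowest terms.\<close>

definition gen_fun_poles :: "(nat \<Rightarrow> 'a::field) \<Rightarrow> 'a alg_closure set" where
  "gen_fun_poles a =
     {z. \<exists>p q. gen_fun_eq a p q \<and> coprime p q \<and> poly (map_poly to_ac q) z = 0}"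

definition virtually_periodic :: "(nat \<Rightarrow> 'a) \<Rightarrow> bool" where
  "virtually_periodic b \<longleftrightarrow> (\<exists>N r. r > 0 \<and> (\<forall>n>N. b (n + r) = b n))"

text \<open>
  The polynomials \<open>P\<^sub>n(T)\<close> are regarded as elements of the field \<open>K(T)\<close>, the type \<open>'k poly fract\<close>;
  the poles in \<open>x\<close> of \<open>\<Sum>\<^sub>n P\<^sub>n(T) x\<^sup>n\<close> then lie in an algebraic closure of \<open>K(T)\<close>, into which
  \<open>K\<close> embeds by the following map.
\<close>

definition const_to_ac :: "'k::field \<Rightarrow> 'k poly fract alg_closure" where
  "const_to_ac c = to_ac (to_fract [:c:])"

end

theory Submission
  imports Defs "HOL-Number_Theory.Cong"
begin

text \<open>
  Let \<open>\<sigma>\<close> range over the finitely many \<open>K\<close>-embeddings of \<open>L\<close> into an algebraic closure of \<open>K\<close>.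
  The minimal polynomial of \<open>a\<^sub>n\<close> is the product of \<open>T - z\<close> over the distinct conjugates \<open>z = \<sigma> a\<^sub>n\<close>.
  The differences \<open>\<sigma> a\<^sub>n - \<tau> a\<^sub>n\<close> satisfy linear recurrences, so by the Skolem--Mahler--Lech theorem
  the pattern of coincidences among the conjugates is virtually periodic; hence so is the degree, and on
  each residue class the coefficients of \<open>P\<^sub>n\<close> are fixed polynomial expressions in recurrence sequences.
  The recurrences descend from the algebraic closure to \<open>K\<close>, which also gives denominators over \<open>K\<close>.

  For Skolem--Mahler--Lech over an arbitrary field of characteristic zero, the sequence lives in a
  finite extension of the quotient field of a polynomial ring \<open>A\<close> over the integers. Taking coordinates and
  clearing denominators moves it into \<open>A\<close>. Specialising the variables to integers reduces to integer
  sequences with last recurrence coefficient prime to \<open>p\<close>, where Hansel's elementary argument applies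
  with a period depending only on \<open>p\<close> and the order of the recurrence, hence uniform in the specialisation.
\<close>

subsection \<open>Integer recurrence sequences\<close>

text \<open>The obstacle is that P_n is not a fixed expression in a_n. A product over all embeddings
  would be one, but the minimal polynomial takes each conjugate once, and which embeddings agree at
  a_n changes with n. Closure properties of recurrences say nothing about where two of them meet. A
  specialisation may create zeros, and each nonzero value needs a specialisation of its own to
  survive. The modulus of the residue classes must therefore be fixed before the value is known: the
  prime is chosen first, and the period is a factorial, a common multiple of all periods that can
  occur. Working modulo p^2 instead of p makes j! harmless for every prime: j! has at most j factors
  p, so p^(2j) / j! keeps p^j, even for p = 2. The P_n are elements of K(T), but the poles must be
  algebraic over K. So each recurrence is tracked together with the subfield that holds its
  coefficients: powers of T may occur as scalars, never in a recurrence.\<close>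

lemma fact_dvd_coprime_times_power:
  assumes "prime (p :: nat)"
  shows "\<exists>w. coprime w p \<and> fact j dvd w * p ^ j"
proof (induction j rule: less_induct)
  case (less j)
  show ?case
  proof (cases "j = 0")
    case True
    then show ?thesis by (intro exI[of _ 1]) simp
  next
    case False
    have p2: "p \<ge> 2" using assms prime_ge_2_nat by blast
    define k where "k = j div p"
    have "k < j" using False p2 by (simp add: k_def)
    with less.IH obtain w where w: "coprime w p" "fact k dvd w * p ^ k" by blast
    \<comment> \<open>The multiples of p up to j are p, 2p, ..., kp. They contribute p^k * k!, and
      the induction hypothesis bounds the powers of p in k!.\<close>
    define N where "N = \<Prod>{i \<in> {1..j}. \<not> p dvd i}"
    have mult: "{i \<in> {1..j}. p dvd i} = (\<lambda>i. p * i) ` {1..k}"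
    proof (intro equalityI subsetI)
      fix i assume "i \<in> {i \<in> {1..j}. p dvd i}"
      then obtain l where l: "i = p * l" "1 \<le> i" "i \<le> j" by (auto elim: dvdE)
      have "l \<le> k" unfolding k_def
        using l p2 by (metis div_le_mono nonzero_mult_div_cancel_left not_numeral_le_zero)
      moreover have "l \<ge> 1" using l by (cases l) auto
      ultimately show "i \<in> (\<lambda>i. p * i) ` {1..k}" using l by auto
    next
      fix i assume "i \<in> (\<lambda>i. p * i) ` {1..k}"
      then obtain l where l: "i = p * l" "1 \<le> l" "l \<le> k" by (elim imageE) (metis atLeastAtMost_iff)
      have "p * l \<le> p * k" using l by simp
      also have "\<dots> \<le> j" unfolding k_def by simp
      finally show "i \<in> {i \<in> {1..j}. p dvd i}" using l p2 by auto
    qed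
    have "fact j = \<Prod>{1..j}" by (simp add: fact_prod)
    also have "{1..j} = {i \<in> {1..j}. \<not> p dvd i} \<union> {i \<in> {1..j}. p dvd i}" by auto
    also have "\<Prod>\<dots> = N * \<Prod>{i \<in> {1..j}. p dvd i}"
      unfolding N_def by (rule prod.union_disjoint) auto
    also have "\<Prod>{i \<in> {1..j}. p dvd i} = (\<Prod>i\<in>{1..k}. p * i)"
      unfolding mult by (subst prod.reindex) (use p2 in \<open>auto simp: inj_on_def\<close>)
    also have "\<dots> = p ^ k * fact k"
      by (simp add: prod.distrib fact_prod)
    finally have fj: "fact j = N * (p ^ k * fact k)" .
    have cN: "coprime N p"
      unfolding N_def using assms
      by (intro prod_coprime_left) (metis (mono_tags, lifting) mem_Collect_eq prime_imp_coprime coprime_commute)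
    have "fact j dvd N * (p ^ k * (w * p ^ k))"
      unfolding fj using w(2) by (intro mult_dvd_mono) auto
    also have "N * (p ^ k * (w * p ^ k)) = (N * w) * p ^ (2 * k)"
      by (simp only: power_mult power2_eq_square power_mult_distrib mult_ac)
    also have "\<dots> dvd (N * w) * p ^ j"
    proof -
      \<comment> \<open>k factors p come from the multiples and at most k from k!; the case p = 2 is
        tight.\<close>
      have "2 * k \<le> p * k" using p2 by simp
      also have "\<dots> \<le> j" unfolding k_def by simp
      finally show ?thesis by (intro mult_dvd_mono le_imp_power_dvd) auto
    qed
    finally show ?thesis using cN w(1) by (intro exI[of _ "N * w"]) simp
  qed
qed

text \<open>Comparing coefficients in W = (X - t) * Q gives Q_i = W_(i+1) + t * Q_(i+1), so
  divisibility descends from the degree of Q, above which everything vanishes.\<close>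

lemma dvd_coeff_of_linear_factor:
  fixes Q :: "int poly"
  assumes "\<And>i. i \<ge> Suc k \<Longrightarrow> q dvd coeff ([:- t, 1:] * Q) i" and "i \<ge> k"
  shows "q dvd coeff Q i"
  using assms(2)
proof (induction "Suc (degree Q) - i" arbitrary: i)
  case 0
  then show ?case by (simp add: coeff_eq_0)
next
  case (Suc x)
  have "coeff ([:- t, 1:] * Q) (Suc i) = coeff Q i - t * coeff Q (Suc i)"
    by simp
  moreover have "q dvd coeff Q (Suc i)"
    by (rule Suc.hyps) (use Suc in auto)
  moreover have "q dvd coeff ([:- t, 1:] * Q) (Suc i)" using Suc.prems by (intro assms(1)) simp
  ultimately show ?case
    by (metis dvd_add_left_iff dvd_mult dvd_mult2 diff_add_cancel dvd_mult_right mult.commute dvd_add)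
qed

text \<open>Each root divided out lowers the index bound by one; after the last one all coefficients
  of the cofactor are divisible by q, hence so are its values.\<close>

lemma dvd_poly_of_many_roots:
  fixes W :: "int poly"
  assumes "finite T" "\<And>t. t \<in> T \<Longrightarrow> poly W t = 0" "\<And>i. i \<ge> card T \<Longrightarrow> q dvd coeff W i"
  shows "q dvd poly W x"
  using assms
proof (induction T arbitrary: W rule: finite_induct)
  case empty
  then show ?case by (auto simp: poly_altdef intro!: dvd_sum)
next
  case (insert t T)
  have "[:- t, 1:] dvd W" using insert.prems(1)[of t] by (simp add: poly_eq_0_iff_dvd)
  then obtain Q where Q: "W = [:- t, 1:] * Q" by (elim dvdE)
  have "q dvd poly Q x"
  proof (rule insert.IH)
    fix t' assume "t' \<in> T"
    with insert.hyps insert.prems(1)[of t'] show "poly Q t' = 0" by (auto simp: Q)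
  next
    fix i assume i: "i \<ge> card T"
    show "q dvd coeff Q i"
      by (rule dvd_coeff_of_linear_factor[of "card T" q t Q i])
        (use insert i Q in auto)
  qed
  then show ?case by (simp add: Q del: mult_pCons_left)
qed

definition falling_poly :: "nat \<Rightarrow> int poly" where
  "falling_poly j = (\<Prod>i<j. [:- int i, 1:])"

lemma degree_falling_poly: "degree (falling_poly j) = j"
proof -
  have "degree (falling_poly j) = (\<Sum>i<j. degree [:- int i, 1:])"
    unfolding falling_poly_def by (rule degree_prod_eq_sum_degree) auto
  then show ?thesis by simp
qed

lemma poly_falling_poly: "poly (falling_poly j) (int n) = fact j * int (n choose j)"
proof (induction j)
  case (Suc j)
  have "poly (falling_poly (Suc j)) (int n) = (int n - int j) * (fact j * int (n choose j))"
    using Suc by (simp add: falling_poly_def left_diff_distrib)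
  also have "\<dots> = fact j * ((int n - int j) * int (n choose j))" by simp
  also have "(int n - int j) * int (n choose j) = int (Suc j) * int (n choose Suc j)"
  proof (cases "j \<le> n")
    case True
    then have "int n - int j = int (n - j)" by simp
    then show ?thesis
      using binomial_absorb_comp[of n j] binomial_absorption[of j n]
      by (metis (no_types, lifting) of_nat_mult mult.commute binomial_absorption binomial_absorb_comp)
  qed (simp add: binomial_eq_0)
  finally show ?case by (simp add: algebra_simps)
qed (simp add: falling_poly_def)

text \<open>Hansel's argument: after multiplication by an integer prime to \<open>p\<close>, the partial sums are integer
  polynomials in \<open>n\<close> whose coefficients of index at least \<open>k\<close> are divisible by \<open>p\<^sup>k\<close>; dividing by
  \<open>k\<close> linear factors makes all values divisible by \<open>p\<^sup>k\<close>.\<close>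
lemma newton_series_infinite_zeros:
  fixes b :: "nat \<Rightarrow> int" and p :: nat
  defines "f \<equiv> \<lambda>n. \<Sum>j\<le>n. int (n choose j) * (int p ^ 2) ^ j * b j"
  assumes "prime p" and inf: "infinite {n. f n = 0}"
  shows "f n = 0"
proof -
  have "int p ^ k dvd f n" for k
  proof -
    obtain T where T: "T \<subseteq> {n. f n = 0}" "finite T" "card T = k"
      using infinite_arbitrarily_large[OF inf] by blast
    \<comment> \<open>The series is cut off at m. The truncation is exact at all points up to m, so
      m must reach n and the chosen zeros.\<close>
    define m where "m = Max (insert n T)"
    have m: "n \<le> m" "\<And>t. t \<in> T \<Longrightarrow> t \<le> m" unfolding m_def using T(2) by auto
    obtain w where w: "\<And>j. coprime (w j) p" "\<And>j. fact j dvd w j * p ^ j"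
      using fact_dvd_coprime_times_power[OF \<open>prime p\<close>] by metis
    \<comment> \<open>U clears the prime-to-p parts of all j! with j \<le> m, so U * p^(2j) / j! is
      an integer multiple of p^j.\<close>
    define U where "U = (\<Prod>j\<le>m. w j)"
    have cU: "coprime U p" unfolding U_def using w(1) by (intro prod_coprime_left) auto
    have "\<exists>y. U * p ^ j = fact j * y" if "j \<le> m" for j
    proof -
      have "w j dvd U" unfolding U_def using that by (intro dvd_prodI) auto
      then have "fact j dvd U * p ^ j" using w(2)[of j] by (meson dvd_trans mult_dvd_mono dvd_refl)
      then show ?thesis by (auto elim: dvdE)
    qed
    then obtain y where y: "\<And>j. j \<le> m \<Longrightarrow> U * p ^ j = fact j * y j" by metis
    define W where "W = (\<Sum>j\<le>m. smult (int p ^ j * int (y j) * b j) (falling_poly j))"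
    have W: "poly W (int x) = int U * f x" if "x \<le> m" for x
    proof -
      have "poly W (int x) = (\<Sum>j\<le>m. int p ^ j * int (y j) * b j * (fact j * int (x choose j)))"
        by (simp add: W_def poly_sum poly_falling_poly)
      also have "\<dots> = (\<Sum>j\<le>m. int U * (int (x choose j) * (int p ^ 2) ^ j * b j))"
      proof (rule sum.cong, goal_cases)
        case (2 j)
        then have "int (U * p ^ j) = int (fact j * y j)" using y[of j] by simp
        then have *: "int U * int p ^ j = fact j * int (y j)" by simp
        have "int p ^ j * int (y j) * b j * (fact j * int (x choose j))
          = int p ^ j * (fact j * int (y j)) * b j * int (x choose j)" by (simp only: mult_ac)
        also have "\<dots> = int U * (int (x choose j) * (int p ^ j * int p ^ j) * b j)"
          unfolding *[symmetric] by (simp only: mult_ac)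
        finally show ?case by (simp add: power2_eq_square power_mult_distrib)
      qed simp
      also have "\<dots> = (\<Sum>j\<le>x. int U * (int (x choose j) * (int p ^ 2) ^ j * b j))"
        by (rule sum.mono_neutral_right) (use that in \<open>auto simp: binomial_eq_0\<close>)
      finally show ?thesis by (simp add: f_def sum_distrib_left)
    qed
    have "int p ^ k dvd poly W (int n)"
    proof (rule dvd_poly_of_many_roots[of "int ` T"])
      show "poly W t = 0" if "t \<in> int ` T" for t
        using that T(1) m(2) W by auto
      fix i assume "card (int ` T) \<le> i"
      then have ik: "k \<le> i" using T(3) by (simp add: card_image)
      \<comment> \<open>The falling polynomial of degree j reaches index i only for j \<ge> i \<ge>
        k, where p^j supplies p^k.\<close>
      have "int p ^ k dvd (int p ^ j * int (y j) * b j) * coeff (falling_poly j) i" for j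
      proof (cases "j < i")
        case True
        then show ?thesis by (simp add: coeff_eq_0 degree_falling_poly)
      next
        case False
        then show ?thesis using ik by (intro dvd_mult2 le_imp_power_dvd) auto
      qed
      then show "int p ^ k dvd coeff W i"
        unfolding W_def by (simp add: coeff_sum dvd_sum)
    qed (use T in auto)
    then have "int p ^ k dvd int U * f n" using W m by simp
    moreover have "coprime (int p ^ k) (int U)" using cU by (simp add: coprime_commute)
    ultimately show ?thesis by (simp add: coprime_dvd_mult_right_iff)
  qed
  moreover obtain k where "\<bar>f n\<bar> < int p ^ k"
    using real_arch_pow[of "real p" "real_of_int \<bar>f n\<bar>"] prime_gt_1_nat[OF \<open>prime p\<close>]
    by (metis of_int_less_iff of_int_of_nat_eq of_int_power of_nat_1 of_nat_less_iff)
  ultimately show ?thesis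
    by (metis abs_of_nonneg dvd_imp_le_int not_less of_nat_0_le_iff zero_le_power)
qed

text \<open>A window of d consecutive residues has at most m^d states. As c 0 is a unit modulo m the
  recurrence also runs backwards, so the period starts at 0. The factorial is a multiple of every
  possible period and serves all c and z at once.\<close>

lemma recurrence_mod_periodic:
  fixes z c :: "nat \<Rightarrow> int" and m d :: nat
  assumes m: "m > 0" and d: "d > 0" and c0: "coprime (c 0) (int m)"
    and rec: "\<And>n. z (n + d) = (\<Sum>i<d. c i * z (n + i))"
  shows "int m dvd z (n + fact (m ^ d)) - z n"
proof -
  define E where "E = (\<lambda>n n'. \<forall>i<d. [z (n + i) = z (n' + i)] (mod int m))"
  have fwd: "E (Suc n) (Suc n')" if "E n n'" for n n'
    unfolding E_def
  proof (intro allI impI)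
    fix i assume i: "i < d"
    show "[z (Suc n + i) = z (Suc n' + i)] (mod int m)"
    proof (cases "Suc i < d")
      case True
      then show ?thesis using that unfolding E_def by (metis add_Suc add_Suc_right)
    next
      case False
      then have "Suc n + i = n + d" "Suc n' + i = n' + d" using i by auto
      then show ?thesis unfolding rec
        using that rec[of n] rec[of n'] unfolding E_def
        by (metis (no_types, lifting) cong_refl cong_mult cong_sum lessThan_iff)
    qed
  qed
  have bwd: "E n n'" if "E (Suc n) (Suc n')" for n n'
    unfolding E_def
  proof (intro allI impI)
    fix i assume i: "i < d"
    have S: "[z (n + j) = z (n' + j)] (mod int m)" if "0 < j" "j \<le> d" for j
      using \<open>E (Suc n) (Suc n')\<close> that unfolding E_def
      by (metis Suc_le_lessD Suc_pred add_Suc_right add_Suc)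
    show "[z (n + i) = z (n' + i)] (mod int m)"
    proof (cases "i = 0")
      case True
      have split: "z (n + d) = c 0 * z n + (\<Sum>i\<in>{1..<d}. c i * z (n + i))" for n
        unfolding rec using d by (simp add: lessThan_atLeast0 sum.atLeast_Suc_lessThan)
      have "[c 0 * z n = c 0 * z n'] (mod int m)"
      proof -
        have "[z (n + d) - (\<Sum>i\<in>{1..<d}. c i * z (n + i))
             = z (n' + d) - (\<Sum>i\<in>{1..<d}. c i * z (n' + i))] (mod int m)"
          by (intro cong_diff cong_sum cong_mult cong_refl S) (use d in auto)
        then show ?thesis by (simp add: split)
      qed
      then show ?thesis using True c0 by (simp add: cong_mult_lcancel)
    qed (use S i in auto)
  qed
  \<comment> \<open>Cutting off outside the window puts the states into a \<open>PiE\<close> with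
    m^d elements, one fewer than the indices in \<open>{..m ^ d}\<close>.\<close>
  define st where "st = (\<lambda>n. restrict (\<lambda>i. z (n + i) mod int m) {..<d})"
  have st_E: "E n n'" if "st n = st n'" for n n'
    unfolding E_def cong_def
  proof (intro allI impI)
    fix i assume "i < d"
    then show "z (n + i) mod int m = z (n' + i) mod int m"
      using fun_cong[OF that, of i] by (simp add: st_def)
  qed
  have "\<not> inj_on st {..m ^ d}"
  proof
    assume "inj_on st {..m ^ d}"
    moreover have "st ` {..m ^ d} \<subseteq> PiE {..<d} (\<lambda>_. {0..<int m})"
      unfolding st_def using m by (intro image_subsetI restrict_PiE_iff[THEN iffD2]) auto
    ultimately have "card {..m ^ d} \<le> card (PiE {..<d} (\<lambda>_. {0..<int m}))"
      by (intro card_inj_on_le) (auto intro: finite_PiE)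
    then show False by (simp add: card_PiE)
  qed
  then obtain i j where ij: "i < j" "j \<le> m ^ d" "E i j"
    unfolding inj_on_def by (metis atMost_iff linorder_neqE_nat st_E)
  \<comment> \<open>Walking the collision back from i to 0 turns it into a pure period.\<close>
  have "E (i - k) (j - k)" if "k \<le> i" for k
    using that
  proof (induction k)
    case (Suc k)
    then have "i - k = Suc (i - Suc k)" "j - k = Suc (j - Suc k)" using ij by auto
    with Suc bwd show ?case by (metis Suc_leD)
  qed (use ij in simp)
  from this[of i] have E0: "E 0 (j - i)" by simp
  define s where "s = j - i"
  have s: "s > 0" "s \<le> m ^ d" using ij by (auto simp: s_def)
  have Es: "E n (n + s)" for n
    by (induction n) (use E0 fwd in \<open>auto simp: s_def\<close>)
  have Esk: "[z n = z (n + s * k)] (mod int m)" for n k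
  proof (induction k)
    case (Suc k)
    have "[z (n + s * k) = z (n + s * k + s)] (mod int m)"
      using Es[of "n + s * k"] d unfolding E_def by force
    with Suc show ?case by (simp add: algebra_simps) (metis cong_trans add.commute)
  qed simp
  have "s dvd fact (m ^ d)" using s by (intro dvd_fact) auto
  then obtain k where "fact (m ^ d) = s * k" by (elim dvdE)
  then show ?thesis using Esk[of n k] by (metis cong_iff_dvd_diff cong_sym)
qed

text \<open>On P the shift by r acts as 1 + m * D, and this is the binomial theorem for its k-th
  power. P restricts to sequences for which D, later a difference quotient, divides exactly.\<close>

lemma newton_expansion:
  fixes D :: "(nat \<Rightarrow> int) \<Rightarrow> nat \<Rightarrow> int"
  assumes step: "\<And>z n. P z \<Longrightarrow> z (n + r) = z n + m * D z n"
    and inv: "\<And>z. P z \<Longrightarrow> P (D z)" and "P z"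
  shows "z (n + r * k) = (\<Sum>i\<le>k. int (k choose i) * m ^ i * (D ^^ i) z n)"
  using \<open>P z\<close>
proof (induction k arbitrary: z)
  case (Suc k)
  define t where "t = (\<lambda>i. m ^ i * (D ^^ i) z n)"
  have "z (n + r * Suc k) = z (n + r * k + r)" by (simp add: algebra_simps)
  also have "\<dots> = z (n + r * k) + m * D z (n + r * k)" using step Suc.prems by simp
  also have "z (n + r * k) = (\<Sum>i\<le>k. int (k choose i) * t i)"
    using Suc by (simp add: t_def mult.assoc)
  also have "m * D z (n + r * k) = (\<Sum>i\<le>k. int (k choose i) * t (Suc i))"
    using Suc.IH[OF inv[OF Suc.prems]]
    by (simp add: t_def sum_distrib_left funpow_swap1 algebra_simps)
  also have "(\<Sum>i\<le>k. int (k choose i) * t i) + (\<Sum>i\<le>k. int (k choose i) * t (Suc i))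
    = (\<Sum>i\<le>Suc k. int (Suc k choose i) * t i)"
  proof -
    have "(\<Sum>i\<le>Suc k. int (Suc k choose i) * t i)
      = t 0 + (\<Sum>i\<le>k. int (Suc k choose Suc i) * t (Suc i))"
      by (subst sum.atMost_Suc_shift) simp
    also have "\<dots> = t 0 + (\<Sum>i\<le>k. int (k choose Suc i) * t (Suc i))
        + (\<Sum>i\<le>k. int (k choose i) * t (Suc i))"
      by (simp add: sum.distrib algebra_simps)
    also have "t 0 + (\<Sum>i\<le>k. int (k choose Suc i) * t (Suc i)) = (\<Sum>i\<le>Suc k. int (k choose i) * t i)"
      by (subst sum.atMost_Suc_shift[of _ k]) simp
    also have "\<dots> = (\<Sum>i\<le>k. int (k choose i) * t i)" by (simp add: binomial_eq_0)
    finally show ?thesis by simp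
  qed
  finally show ?case by (simp add: t_def mult.assoc)
qed simp

text \<open>Along n + r * k the sequence is a binomial series in k with weights p^(2i), the shape
  treated by \<open>newton_series_infinite_zeros\<close>.\<close>

lemma int_recurrence_infinite_zeros:
  fixes z c :: "nat \<Rightarrow> int" and p d :: nat
  defines "r \<equiv> fact ((p\<^sup>2) ^ d)"
  assumes p: "prime p" and d: "d > 0" and c0: "\<not> int p dvd c 0"
    and rec: "\<And>n. z (n + d) = (\<Sum>i<d. c i * z (n + i))"
    and inf: "infinite {k. z (n + r * k) = 0}"
  shows "z (n + r * k) = 0"
proof -
  define P where "P = (\<lambda>z. \<forall>n. z (n + d) = (\<Sum>i<d. c i * z (n + i)))"
  define D where "D = (\<lambda>z n. (z (n + r) - z n) div int (p\<^sup>2))"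
  have p0: "p > 0" using p prime_gt_0_nat by blast
  have cop: "coprime (c 0) (int (p\<^sup>2))"
    using p c0 by (simp add: coprime_commute prime_imp_coprime)
  have step: "z (n + r) = z n + int (p\<^sup>2) * D z n" if "P z" for z n
    using recurrence_mod_periodic[of "p\<^sup>2" d c z n] p0 d cop that
    unfolding P_def D_def r_def by simp
  have inv: "P (D z)" if "P z" for z
    unfolding P_def
  proof
    fix n
    have "int (p\<^sup>2) * D z (n + d) = z ((n + r) + d) - z (n + d)"
      using step[OF that, of "n + d"] by (simp add: add_ac)
    also have "\<dots> = (\<Sum>i<d. c i * z ((n + r) + i)) - (\<Sum>i<d. c i * z (n + i))"
      using that unfolding P_def by (metis (no_types))
    also have "\<dots> = (\<Sum>i<d. c i * (z (n + i + r) - z (n + i)))"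
      by (simp only: sum_subtractf right_diff_distrib add_ac)
    also have "\<dots> = (\<Sum>i<d. c i * (int (p\<^sup>2) * D z (n + i)))"
      using step[OF that] by simp
    also have "\<dots> = int (p\<^sup>2) * (\<Sum>i<d. c i * D z (n + i))"
      by (simp add: sum_distrib_left algebra_simps)
    \<comment> \<open>Cancelling p^2 shows that D z solves the same recurrence, so D can be
      iterated.\<close>
    finally show "D z (n + d) = (\<Sum>i<d. c i * D z (n + i))" using p0 by simp
  qed
  have "P z" using rec by (simp add: P_def)
  have *: "z (n + r * k) = (\<Sum>i\<le>k. int (k choose i) * (int p ^ 2) ^ i * (D ^^ i) z n)" for k
    using newton_expansion[of P r "int (p\<^sup>2)" D z n k, OF step inv \<open>P z\<close>] by simp
  show ?thesis
    unfolding * by (rule newton_series_infinite_zeros[OF p]) (use inf in \<open>simp add: *\<close>)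
qed

subsection \<open>Subrings and subfields\<close>

text \<open>Rings and fields are sets inside one type, because the towers below are built by
  induction and their members cannot be types.\<close>

definition is_subring :: "'a::comm_ring_1 set \<Rightarrow> bool" where
  "is_subring S \<longleftrightarrow> 0 \<in> S \<and> 1 \<in> S \<and>
     (\<forall>x\<in>S. \<forall>y\<in>S. x + y \<in> S \<and> x * y \<in> S) \<and> (\<forall>x\<in>S. - x \<in> S)"

lemma is_subfield_imp_subring: "is_subfield F \<Longrightarrow> is_subring F"
  by (auto simp: is_subfield_def is_subring_def)

lemma is_subfield_UNIV: "is_subfield UNIV"
  by (simp add: is_subfield_def)

lemma subring_0: "is_subring S \<Longrightarrow> 0 \<in> S"
  and subring_1: "is_subring S \<Longrightarrow> 1 \<in> S"
  and subring_add: "is_subring S \<Longrightarrow> x \<in> S \<Longrightarrow> y \<in> S \<Longrightarrow> x + y \<in> S"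
  and subring_mult: "is_subring S \<Longrightarrow> x \<in> S \<Longrightarrow> y \<in> S \<Longrightarrow> x * y \<in> S"
  and subring_uminus: "is_subring S \<Longrightarrow> x \<in> S \<Longrightarrow> - x \<in> S"
  by (auto simp: is_subring_def)

lemma subring_diff: "is_subring S \<Longrightarrow> x \<in> S \<Longrightarrow> y \<in> S \<Longrightarrow> x - y \<in> S"
  using subring_add[of S x "- y"] subring_uminus[of S y] by simp

lemma subring_sum: "is_subring S \<Longrightarrow> (\<And>i. i \<in> I \<Longrightarrow> f i \<in> S) \<Longrightarrow> sum f I \<in> S"
  by (induction I rule: infinite_finite_induct) (auto simp: subring_0 subring_add)

lemma subring_power: "is_subring S \<Longrightarrow> x \<in> S \<Longrightarrow> x ^ n \<in> S"
  by (induction n) (auto simp: subring_1 subring_mult)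

lemma subring_of_nat: "is_subring S \<Longrightarrow> of_nat n \<in> S"
  by (induction n) (auto simp: subring_0 subring_1 subring_add)

lemma subring_of_int: "is_subring S \<Longrightarrow> of_int n \<in> S"
  by (cases n) (auto simp: subring_of_nat subring_1 subring_diff subring_uminus)

lemma subfield_inverse: "is_subfield F \<Longrightarrow> x \<in> F \<Longrightarrow> inverse x \<in> F"
  by (auto simp: is_subfield_def)

lemma subfield_divide: "is_subfield F \<Longrightarrow> x \<in> F \<Longrightarrow> y \<in> F \<Longrightarrow> x / y \<in> F"
  by (simp add: divide_inverse subfield_inverse is_subfield_imp_subring subring_mult)

lemma is_subfieldI:
  assumes "is_subring F" "\<And>x. x \<in> F \<Longrightarrow> x \<noteq> 0 \<Longrightarrow> inverse x \<in> F"
  shows "is_subfield F"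
  using assms unfolding is_subfield_def is_subring_def by (metis inverse_zero)

text \<open>Gaussian elimination. That the solution stays in F is what later keeps the coefficients
  of recurrences in F.\<close>

lemma homogeneous_system_solution:
  assumes F: "is_subfield F" and "finite I" "finite J" "card I < card J"
    and "\<And>i j. i \<in> I \<Longrightarrow> j \<in> J \<Longrightarrow> c i j \<in> F"
  shows "\<exists>x. (\<forall>j\<in>J. x j \<in> F) \<and> (\<exists>j\<in>J. x j \<noteq> 0) \<and> (\<forall>i\<in>I. (\<Sum>j\<in>J. c i j * x j) = 0)"
  using assms(2-)
proof (induction I arbitrary: J c rule: finite_induct)
  case empty
  then obtain j where "j \<in> J" by fastforce
  then show ?case
    using F by (intro exI[of _ "\<lambda>_. 1"]) (auto simp: is_subfield_def)
next
  case (insert i I)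
  note R = is_subfield_imp_subring[OF F]
  show ?case
  proof (cases "\<forall>j\<in>J. c i j = 0")
    case True
    have "\<exists>x. (\<forall>j\<in>J. x j \<in> F) \<and> (\<exists>j\<in>J. x j \<noteq> 0) \<and> (\<forall>i\<in>I. (\<Sum>j\<in>J. c i j * x j) = 0)"
      by (rule insert.IH) (use insert in auto)
    then show ?thesis using True by auto
  next
    case False
    then obtain j0 where j0: "j0 \<in> J" "c i j0 \<noteq> 0" by blast
    define J' where "J' = J - {j0}"
    \<comment> \<open>Equation i eliminates the unknown j0; y below restores it.\<close>
    define c' where "c' = (\<lambda>k j. c k j - c k j0 * c i j / c i j0)"
    have J: "J = insert j0 J'" "j0 \<notin> J'" "finite J'" using j0 insert.prems by (auto simp: J'_def)
    have "\<exists>x. (\<forall>j\<in>J'. x j \<in> F) \<and> (\<exists>j\<in>J'. x j \<noteq> 0) \<and> (\<forall>i\<in>I. (\<Sum>j\<in>J'. c' i j * x j) = 0)"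
    proof (rule insert.IH)
      show "card I < card J'" using insert.prems insert.hyps J by simp
      show "c' k j \<in> F" if "k \<in> I" "j \<in> J'" for k j
        unfolding c'_def using that insert.prems j0 J
        by (intro subring_diff[OF R] subfield_divide[OF F] subring_mult[OF R]) auto
    qed (use J in auto)
    then obtain x where x: "\<forall>j\<in>J'. x j \<in> F" "\<exists>j\<in>J'. x j \<noteq> 0"
      "\<forall>i\<in>I. (\<Sum>j\<in>J'. c' i j * x j) = 0" by blast
    define s where "s = (\<Sum>j\<in>J'. c i j * x j)"
    define y where "y = x(j0 := - s / c i j0)"
    have sum: "(\<Sum>j\<in>J. c k j * y j) = (\<Sum>j\<in>J'. c k j * x j) - c k j0 * s / c i j0" for k
    proof -
      have "(\<Sum>j\<in>J'. c k j * y j) = (\<Sum>j\<in>J'. c k j * x j)"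
        using J(2) by (intro sum.cong) (auto simp: y_def)
      then show ?thesis using J by (simp add: y_def)
    qed
    have "s \<in> F" unfolding s_def using insert.prems x J by (intro subring_sum[OF R] subring_mult[OF R]) auto
    then have "\<forall>j\<in>J. y j \<in> F"
      using x(1) J insert.prems unfolding y_def
      by (auto intro!: subfield_divide[OF F] subring_uminus[OF R])
    moreover have "\<exists>j\<in>J. y j \<noteq> 0" using x(2) J by (auto simp: y_def)
    moreover have "(\<Sum>j\<in>J. c k j * y j) = 0" if "k \<in> insert i I" for k
    proof (cases "k = i")
      case True
      then show ?thesis using j0 sum[of i] by (simp add: s_def)
    next
      case False
      then have "(\<Sum>j\<in>J'. c' k j * x j) = 0" using that x by auto
      moreover have "(\<Sum>j\<in>J'. c' k j * x j) = (\<Sum>j\<in>J'. c k j * x j) - c k j0 * s / c i j0"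
        by (simp add: c'_def s_def sum_subtractf sum_distrib_left sum_divide_distrib algebra_simps)
      ultimately show ?thesis by (simp add: sum)
    qed
    ultimately show ?thesis by blast
  qed
qed

subsection \<open>Linear recurrence sequences\<close>

text \<open>Any nonzero relation counts, whatever its first and last coefficients: this matches an
  arbitrary nonzero denominator and survives a change of finitely many terms. The values of a may
  lie outside F.\<close>

definition lin_rec :: "'a::field set \<Rightarrow> (nat \<Rightarrow> 'a) \<Rightarrow> bool" where
  "lin_rec F a \<longleftrightarrow> (\<exists>D c. (\<forall>i\<le>D. c i \<in> F) \<and> (\<exists>i\<le>D. c i \<noteq> 0) \<and>
     (\<forall>n. (\<Sum>i\<le>D. c i * a (n + i)) = 0))"

definition seq_span :: "'a::field set \<Rightarrow> (nat \<Rightarrow> 'a) set \<Rightarrow> (nat \<Rightarrow> 'a) set" where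
  "seq_span F B = {f. \<exists>c. (\<forall>b\<in>B. c b \<in> F) \<and> (\<forall>n. f n = (\<Sum>b\<in>B. c b * b n))}"

text \<open>The generators in B are arbitrary sequences, not only shifts of a; closure under sums
  and products becomes a matter of choosing generators.\<close>

definition fin_rec :: "'a::field set \<Rightarrow> (nat \<Rightarrow> 'a) \<Rightarrow> bool" where
  "fin_rec F a \<longleftrightarrow> (\<exists>B. finite B \<and> (\<forall>k. (\<lambda>n. a (n + k)) \<in> seq_span F B))"

lemma seq_span_base:
  assumes "is_subring F" "finite B" "b \<in> B"
  shows "b \<in> seq_span F B"
proof -
  have "b n = (\<Sum>b'\<in>B. (if b' = b then 1 else 0) * b' n)" for n
  proof -
    have "(\<Sum>b'\<in>B. (if b' = b then 1 else 0) * b' n) = (\<Sum>b'\<in>B. if b' = b then b' n else 0)"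
      by (rule sum.cong) auto
    then show ?thesis using assms by simp
  qed
  then show ?thesis
    using assms unfolding seq_span_def
    by (auto intro!: exI[of _ "\<lambda>b'. if b' = b then 1 else 0"] simp: subring_0 subring_1)
qed

lemma seq_span_0: "is_subring F \<Longrightarrow> (\<lambda>n. 0) \<in> seq_span F B"
  unfolding seq_span_def by (auto intro!: exI[of _ "\<lambda>b. 0"] simp: subring_0)

lemma seq_span_add:
  assumes "is_subring F" "f \<in> seq_span F B" "g \<in> seq_span F B"
  shows "(\<lambda>n. f n + g n) \<in> seq_span F B"
proof -
  from assms obtain c d where "\<forall>b\<in>B. c b \<in> F" "\<forall>n. f n = (\<Sum>b\<in>B. c b * b n)"
    "\<forall>b\<in>B. d b \<in> F" "\<forall>n. g n = (\<Sum>b\<in>B. d b * b n)" by (auto simp: seq_span_def)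
  then show ?thesis using assms(1) unfolding seq_span_def
    by (auto intro!: exI[of _ "\<lambda>b. c b + d b"] simp: subring_add sum.distrib ring_distribs)
qed

lemma seq_span_scale:
  assumes "is_subring F" "f \<in> seq_span F B" "s \<in> F"
  shows "(\<lambda>n. s * f n) \<in> seq_span F B"
proof -
  from assms obtain c where "\<forall>b\<in>B. c b \<in> F" "\<forall>n. f n = (\<Sum>b\<in>B. c b * b n)"
    by (auto simp: seq_span_def)
  then show ?thesis using assms unfolding seq_span_def
    by (auto intro!: exI[of _ "\<lambda>b. s * c b"] simp: subring_mult sum_distrib_left mult.assoc)
qed

lemma seq_span_sum:
  assumes "is_subring F" "\<And>i. i \<in> I \<Longrightarrow> f i \<in> seq_span F B"
  shows "(\<lambda>n. \<Sum>i\<in>I. f i n) \<in> seq_span F B"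
  using assms(2)
  by (induction I rule: infinite_finite_induct)
    (auto simp: seq_span_0[OF assms(1)] intro!: seq_span_add[OF assms(1)])

lemma seq_span_lincomb:
  assumes "is_subring F" "\<And>i. i \<in> I \<Longrightarrow> c i \<in> F" "\<And>i. i \<in> I \<Longrightarrow> f i \<in> seq_span F B"
  shows "(\<lambda>n. \<Sum>i\<in>I. c i * f i n) \<in> seq_span F B"
  using assms by (intro seq_span_sum seq_span_scale) auto

lemma seq_span_mono:
  assumes "is_subring F" "finite B'" "B \<subseteq> B'"
  shows "seq_span F B \<subseteq> seq_span F B'"
proof
  fix f assume "f \<in> seq_span F B"
  then obtain c where c: "\<forall>b\<in>B. c b \<in> F" "\<And>n. f n = (\<Sum>b\<in>B. c b * b n)"
    by (auto simp: seq_span_def)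
  have "f = (\<lambda>n. \<Sum>b\<in>B. c b * b n)" using c by auto
  also have "\<dots> \<in> seq_span F B'"
    using assms c by (intro seq_span_lincomb seq_span_base) auto
  finally show "f \<in> seq_span F B'" .
qed

lemma lin_rec_leading:
  assumes "is_subfield F" "lin_rec F a"
  obtains d c where "\<And>i. i < d \<Longrightarrow> c i \<in> F" "\<And>n. a (n + d) = (\<Sum>i<d. c i * a (n + i))"
proof -
  from assms obtain D c where c: "\<forall>i\<le>D. c i \<in> F" "\<exists>i\<le>D. c i \<noteq> 0"
    "\<And>n. (\<Sum>i\<le>D. c i * a (n + i)) = 0" by (auto simp: lin_rec_def)
  \<comment> \<open>The last nonzero coefficient becomes the leading one; d = 0 is possible and
    means that a vanishes.\<close>
  define d where "d = Max {i. i \<le> D \<and> c i \<noteq> 0}"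
  have fin: "finite {i. i \<le> D \<and> c i \<noteq> 0}" by simp
  have d: "d \<le> D" "c d \<noteq> 0" using Max_in[OF fin] c(2) unfolding d_def by auto
  have z: "c i = 0" if "i \<le> D" "i > d" for i
    using Max_ge[OF fin, of i] that unfolding d_def[symmetric] by fastforce
  note R = is_subfield_imp_subring[OF assms(1)]
  show thesis
  proof
    show "- (c i / c d) \<in> F" if "i < d" for i
      using that d c by (intro subring_uminus[OF R] subfield_divide[OF assms(1)]) auto
    fix n
    have "0 = (\<Sum>i\<le>D. c i * a (n + i))" using c by simp
    also have "\<dots> = (\<Sum>i\<le>d. c i * a (n + i))"
      by (rule sum.mono_neutral_right) (use d z in auto)
    also have "\<dots> = (\<Sum>i<d. c i * a (n + i)) + c d * a (n + d)"
      by (simp add: lessThan_Suc_atMost[symmetric])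
    finally have "c d * a (n + d) = - (\<Sum>i<d. c i * a (n + i))"
      by (simp add: eq_neg_iff_add_eq_0 add.commute)
    then have "a (n + d) = - (\<Sum>i<d. c i * a (n + i)) / c d"
      using d by (simp add: field_simps)
    also have "\<dots> = (\<Sum>i<d. - (c i / c d) * a (n + i))"
      by (simp add: sum_divide_distrib sum_negf)
    finally show "a (n + d) = (\<Sum>i<d. - (c i / c d) * a (n + i))" .
  qed
qed

lemma lin_rec_imp_fin_rec:
  assumes F: "is_subfield F" and "lin_rec F a"
  shows "fin_rec F a"
proof -
  note R = is_subfield_imp_subring[OF F]
  obtain d c where c: "\<And>i. i < d \<Longrightarrow> c i \<in> F" and rec: "\<And>n. a (n + d) = (\<Sum>i<d. c i * a (n + i))"
    using lin_rec_leading[OF assms] by blast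
  define B where "B = (\<lambda>i n. a (n + i)) ` {..<d}"
  have "(\<lambda>n. a (n + k)) \<in> seq_span F B" for k
  proof (induction k rule: less_induct)
    case (less k)
    show ?case
    proof (cases "k < d")
      case True
      then show ?thesis by (intro seq_span_base[OF R]) (auto simp: B_def)
    next
      case False
      have "(\<lambda>n. a (n + k)) = (\<lambda>n. \<Sum>i<d. c i * a (n + ((k - d) + i)))"
      proof
        fix n
        show "a (n + k) = (\<Sum>i<d. c i * a (n + ((k - d) + i)))"
          using rec[of "n + (k - d)"] False by (simp add: add.assoc)
      qed
      also have "\<dots> \<in> seq_span F B"
      proof (rule seq_span_lincomb[OF R])
        show "(\<lambda>n. a (n + ((k - d) + i))) \<in> seq_span F B" if "i \<in> {..<d}" for i
          by (rule less.IH) (use False that in auto)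
      qed (use c in auto)
      finally show ?thesis .
    qed
  qed
  then show ?thesis unfolding fin_rec_def by (intro exI[of _ B]) (auto simp: B_def)
qed

text \<open>card B + 1 shifts expressed through card B generators are linearly dependent over
  F.\<close>

lemma fin_rec_imp_lin_rec:
  assumes F: "is_subfield F" and "fin_rec F a"
  shows "lin_rec F a"
proof -
  from assms obtain B where B: "finite B" "\<And>k. (\<lambda>n. a (n + k)) \<in> seq_span F B"
    by (auto simp: fin_rec_def)
  from B(2) have "\<forall>k. \<exists>c. (\<forall>b\<in>B. c b \<in> F) \<and> (\<forall>n. a (n + k) = (\<Sum>b\<in>B. c b * b n))"
    by (auto simp: seq_span_def)
  then obtain c where c: "\<And>k b. b \<in> B \<Longrightarrow> c k b \<in> F" "\<And>k n. a (n + k) = (\<Sum>b\<in>B. c k b * b n)"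
    by metis
  have "\<exists>x. (\<forall>k\<in>{..card B}. x k \<in> F) \<and> (\<exists>k\<in>{..card B}. x k \<noteq> 0) \<and>
      (\<forall>b\<in>B. (\<Sum>k\<in>{..card B}. c k b * x k) = 0)"
    by (rule homogeneous_system_solution[OF F]) (use B c in auto)
  then obtain x where x: "\<forall>k\<le>card B. x k \<in> F" "\<exists>k\<le>card B. x k \<noteq> 0"
      "\<And>b. b \<in> B \<Longrightarrow> (\<Sum>k\<le>card B. c k b * x k) = 0" by auto
  have "(\<Sum>k\<le>card B. x k * a (n + k)) = 0" for n
  proof -
    have "(\<Sum>k\<le>card B. x k * a (n + k)) = (\<Sum>k\<le>card B. \<Sum>b\<in>B. c k b * x k * b n)"
      by (simp add: c(2) sum_distrib_left mult_ac)
    also have "\<dots> = (\<Sum>b\<in>B. (\<Sum>k\<le>card B. c k b * x k) * b n)"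
      by (subst sum.swap) (simp add: sum_distrib_right)
    finally show ?thesis using x(3) by simp
  qed
  with x show ?thesis unfolding lin_rec_def by blast
qed

lemma lin_rec_iff_fin_rec: "is_subfield F \<Longrightarrow> lin_rec F a \<longleftrightarrow> fin_rec F a"
  using lin_rec_imp_fin_rec fin_rec_imp_lin_rec by blast

section \<open>Closure properties of recurrence sequences\<close>

lemma lin_rec_add:
  assumes F: "is_subfield F" and "lin_rec F a" "lin_rec F b"
  shows "lin_rec F (\<lambda>n. a n + b n)"
proof -
  note R = is_subfield_imp_subring[OF F]
  from assms obtain A B where AB: "finite A" "\<And>k. (\<lambda>n. a (n + k)) \<in> seq_span F A"
    "finite B" "\<And>k. (\<lambda>n. b (n + k)) \<in> seq_span F B"
    by (auto simp: lin_rec_iff_fin_rec fin_rec_def)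
  have "(\<lambda>n. a (n + k) + b (n + k)) \<in> seq_span F (A \<union> B)" for k
    using AB seq_span_mono[OF R, of "A \<union> B" A] seq_span_mono[OF R, of "A \<union> B" B]
    by (intro seq_span_add[OF R]) auto
  then have "fin_rec F (\<lambda>n. a n + b n)"
    unfolding fin_rec_def using AB by (intro exI[of _ "A \<union> B"]) auto
  then show ?thesis using F by (simp add: lin_rec_iff_fin_rec)
qed

lemma lin_rec_mult:
  assumes F: "is_subfield F" and "lin_rec F a" "lin_rec F b"
  shows "lin_rec F (\<lambda>n. a n * b n)"
proof -
  note R = is_subfield_imp_subring[OF F]
  from assms obtain A B where AB: "finite A" "\<And>k. (\<lambda>n. a (n + k)) \<in> seq_span F A"
    "finite B" "\<And>k. (\<lambda>n. b (n + k)) \<in> seq_span F B"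
    by (auto simp: lin_rec_iff_fin_rec fin_rec_def)
  \<comment> \<open>The pairwise products of generators span all shifts of the product.\<close>
  define C where "C = (\<lambda>(f, g) n. f n * g n :: 'a) ` (A \<times> B)"
  have C: "finite C" using AB by (simp add: C_def)
  have "(\<lambda>n. a (n + k) * b (n + k)) \<in> seq_span F C" for k
  proof -
    from AB(2)[of k] obtain c where c: "\<forall>f\<in>A. c f \<in> F" "\<And>n. a (n + k) = (\<Sum>f\<in>A. c f * f n)"
      by (auto simp: seq_span_def)
    from AB(4)[of k] obtain d where d: "\<forall>f\<in>B. d f \<in> F" "\<And>n. b (n + k) = (\<Sum>f\<in>B. d f * f n)"
      by (auto simp: seq_span_def)
    have "(\<lambda>n. a (n + k) * b (n + k)) = (\<lambda>n. \<Sum>f\<in>A. c f * (\<Sum>g\<in>B. d g * (f n * g n)))"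
      unfolding c d sum_product by (simp only: sum_distrib_left mult_ac)
    also have "\<dots> \<in> seq_span F C"
      by (intro seq_span_lincomb[OF R] seq_span_base[OF R C]) (use c d in \<open>auto simp: C_def\<close>)
    finally show ?thesis .
  qed
  then have "fin_rec F (\<lambda>n. a n * b n)"
    unfolding fin_rec_def using C by blast
  then show ?thesis using F by (simp add: lin_rec_iff_fin_rec)
qed

text \<open>The factor s ranges over the whole field; with F the constants of K(T) this admits
  powers of T.\<close>

lemma lin_rec_scale:
  assumes "lin_rec F a"
  shows "lin_rec F (\<lambda>n. s * a n)"
proof -
  from assms obtain D c where c: "\<forall>i\<le>D. c i \<in> F" "\<exists>i\<le>D. c i \<noteq> 0"
    "\<And>n. (\<Sum>i\<le>D. c i * a (n + i)) = 0" by (auto simp: lin_rec_def)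
  have "(\<Sum>i\<le>D. c i * (s * a (n + i))) = s * (\<Sum>i\<le>D. c i * a (n + i))" for n
    by (simp add: sum_distrib_left mult_ac)
  with c show ?thesis unfolding lin_rec_def by (metis mult_zero_right)
qed

lemma lin_rec_0: "is_subring F \<Longrightarrow> lin_rec F (\<lambda>n. 0)"
  unfolding lin_rec_def by (rule exI[of _ 0], rule exI[of _ "\<lambda>_. 1"]) (auto simp: subring_1)

lemma lin_rec_periodic:
  assumes "is_subring F" "r > 0" "\<And>n. a (n + r) = a n"
  shows "lin_rec F a"
proof -
  \<comment> \<open>The coefficients are those of 1 - X^r.\<close>
  have "(\<Sum>i\<le>r. (if i = 0 then 1 else if i = r then - 1 else 0) * a (n + i)) = 0" for n
  proof -
    have "(\<Sum>i\<le>r. (if i = 0 then 1 else if i = r then - 1 else 0) * a (n + i))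
        = (\<Sum>i\<in>{0, r}. (if i = 0 then 1 else if i = r then - 1 else 0) * a (n + i))"
      by (rule sum.mono_neutral_right) auto
    then show ?thesis using assms by simp
  qed
  then show ?thesis
    unfolding lin_rec_def using assms
    by (intro exI[of _ r] exI[of _ "\<lambda>i. if i = 0 then 1 else if i = r then - 1 else 0"])
      (auto simp: subring_0 subring_1 subring_uminus)
qed

lemma lin_rec_const: "is_subring F \<Longrightarrow> lin_rec F (\<lambda>n. s)"
  by (rule lin_rec_periodic[of _ 1]) auto

lemma lin_rec_sum:
  assumes "is_subfield F" "\<And>i. i \<in> I \<Longrightarrow> lin_rec F (f i)"
  shows "lin_rec F (\<lambda>n. \<Sum>i\<in>I. f i n)"
  using assms(2)
  by (induction I rule: infinite_finite_induct)
    (auto intro!: lin_rec_add[OF assms(1)] lin_rec_0 is_subfield_imp_subring[OF assms(1)])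

lemma lin_rec_uminus: "lin_rec F a \<Longrightarrow> lin_rec F (\<lambda>n. - a n)"
  using lin_rec_scale[of F a "- 1"] by simp

lemma lin_rec_diff:
  "is_subfield F \<Longrightarrow> lin_rec F a \<Longrightarrow> lin_rec F b \<Longrightarrow> lin_rec F (\<lambda>n. a n - b n)"
  using lin_rec_add[of F a "\<lambda>n. - b n"] lin_rec_uminus[of F b] by simp

text \<open>N zero coefficients put in front of the relation make it ignore the first N
  terms.\<close>

lemma lin_rec_of_shift:
  assumes "is_subring F" "lin_rec F (\<lambda>n. a (n + N))"
  shows "lin_rec F a"
proof -
  from assms obtain D c where c: "\<forall>i\<le>D. c i \<in> F" "\<exists>i\<le>D. c i \<noteq> 0"
    "\<And>n. (\<Sum>i\<le>D. c i * a (n + i + N)) = 0" by (auto simp: lin_rec_def)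
  define c' where "c' = (\<lambda>i. if i < N then 0 else c (i - N))"
  have "(\<Sum>i\<le>D + N. c' i * a (n + i)) = 0" for n
  proof -
    have "(\<Sum>i\<le>D + N. c' i * a (n + i)) = (\<Sum>i\<in>{N..D + N}. c' i * a (n + i))"
      by (rule sum.mono_neutral_right) (auto simp: c'_def)
    also have "\<dots> = (\<Sum>i\<in>{0..D}. c' (i + N) * a (n + (i + N)))"
      using sum.shift_bounds_cl_nat_ivl[of "\<lambda>i. c' i * a (n + i)" 0 N D] by simp
    also have "\<dots> = (\<Sum>i\<le>D. c i * a (n + i + N))"
      by (simp add: c'_def atMost_atLeast0 add.assoc)
    finally show ?thesis using c by simp
  qed
  moreover have "\<exists>i\<le>D + N. c' i \<noteq> 0"
  proof -
    from c(2) obtain i where "i \<le> D" "c i \<noteq> 0" by blast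
    then show ?thesis by (intro exI[of _ "i + N"]) (simp add: c'_def)
  qed
  ultimately show ?thesis
    unfolding lin_rec_def using c(1) subring_0[OF assms(1)]
    by (intro exI[of _ "D + N"] exI[of _ c']) (auto simp: c'_def)
qed

lemma lin_rec_shift:
  assumes "lin_rec F a"
  shows "lin_rec F (\<lambda>n. a (n + N))"
proof -
  from assms obtain D c where c: "\<forall>i\<le>D. c i \<in> F" "\<exists>i\<le>D. c i \<noteq> 0"
    "\<And>n. (\<Sum>i\<le>D. c i * a (n + i)) = 0" by (auto simp: lin_rec_def)
  have "(\<Sum>i\<le>D. c i * a (n + i + N)) = 0" for n
    using c(3)[of "n + N"] by (simp add: add_ac)
  with c show ?thesis unfolding lin_rec_def by blast
qed

text \<open>The indicator of a residue class is periodic, hence a recurrence sequence; products and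
  sums glue the b j together, and a shift discards the terms up to N.\<close>

lemma lin_rec_residue_classes:
  assumes F: "is_subfield F" and r: "r > 0"
    and b: "\<And>j. j < r \<Longrightarrow> lin_rec F (b j)"
    and eq: "\<And>n. n > N \<Longrightarrow> a n = b (n mod r) n"
  shows "lin_rec F a"
proof -
  note R = is_subfield_imp_subring[OF F]
  define ind where "ind = (\<lambda>j n. if n mod r = j then 1 else 0 :: 'a)"
  have "lin_rec F (ind j)" for j
    by (rule lin_rec_periodic[OF R r]) (simp add: ind_def)
  then have L: "lin_rec F (\<lambda>n. \<Sum>j<r. ind j n * b j n)"
    using b by (intro lin_rec_sum[OF F] lin_rec_mult[OF F]) auto
  have "(\<Sum>j<r. ind j n * b j n) = b (n mod r) n" for n
  proof -
    have "(\<Sum>j<r. ind j n * b j n) = (\<Sum>j<r. if n mod r = j then b j n else 0)"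
      by (rule sum.cong) (auto simp: ind_def)
    then show ?thesis using r by (simp add: sum.delta)
  qed
  then have "(\<lambda>n. (\<Sum>j<r. ind j (n + Suc N) * b j (n + Suc N))) = (\<lambda>n. a (n + Suc N))"
    using eq by simp
  then have "lin_rec F (\<lambda>n. a (n + Suc N))" using lin_rec_shift[OF L, of "Suc N"] by simp
  then show ?thesis by (rule lin_rec_of_shift[OF R])
qed

subsection \<open>Polynomials over a subring and simple extensions\<close>

definition poly_over :: "'a::comm_ring_1 set \<Rightarrow> 'a poly set" where
  "poly_over A = {p. \<forall>i. coeff p i \<in> A}"

definition ring_adjoin :: "'a::comm_ring_1 set \<Rightarrow> 'a \<Rightarrow> 'a set" where
  "ring_adjoin A x = (\<lambda>p. poly p x) ` poly_over A"

definition alg_over :: "'a::comm_ring_1 set \<Rightarrow> 'a \<Rightarrow> bool" where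
  "alg_over A x \<longleftrightarrow> (\<exists>p\<in>poly_over A. p \<noteq> 0 \<and> poly p x = 0)"

text \<open>Only the values on A are constrained, so a map can be extended along a tower of sets
  without a change of type.\<close>

definition hom_on :: "'a::comm_ring_1 set \<Rightarrow> ('a \<Rightarrow> 'b::comm_ring_1) \<Rightarrow> bool" where
  "hom_on A f \<longleftrightarrow> f 1 = 1 \<and> (\<forall>x\<in>A. \<forall>y\<in>A. f (x + y) = f x + f y \<and> f (x * y) = f x * f y)"

lemma poly_over_mono: "A \<subseteq> B \<Longrightarrow> poly_over A \<subseteq> poly_over B"
  by (auto simp: poly_over_def)

lemma alg_over_mono: "A \<subseteq> B \<Longrightarrow> alg_over A x \<Longrightarrow> alg_over B x"
  using poly_over_mono unfolding alg_over_def by blast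

lemma poly_over_pCons_iff: "pCons a p \<in> poly_over A \<longleftrightarrow> a \<in> A \<and> p \<in> poly_over A"
proof
  assume "pCons a p \<in> poly_over A"
  then have *: "coeff (pCons a p) i \<in> A" for i by (simp add: poly_over_def)
  show "a \<in> A \<and> p \<in> poly_over A"
    using *[of 0] *[of "Suc i" for i] by (auto simp: poly_over_def)
qed (auto simp: poly_over_def coeff_pCons split: nat.split)

lemma poly_over_0: "is_subring A \<Longrightarrow> 0 \<in> poly_over A"
  by (simp add: poly_over_def subring_0)

lemma poly_over_add: "is_subring A \<Longrightarrow> p \<in> poly_over A \<Longrightarrow> q \<in> poly_over A \<Longrightarrow> p + q \<in> poly_over A"
  by (simp add: poly_over_def subring_add)

lemma poly_over_uminus: "is_subring A \<Longrightarrow> p \<in> poly_over A \<Longrightarrow> - p \<in> poly_over A"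
  by (simp add: poly_over_def subring_uminus)

lemma poly_over_diff: "is_subring A \<Longrightarrow> p \<in> poly_over A \<Longrightarrow> q \<in> poly_over A \<Longrightarrow> p - q \<in> poly_over A"
  by (simp add: poly_over_def subring_diff)

lemma poly_over_mult: "is_subring A \<Longrightarrow> p \<in> poly_over A \<Longrightarrow> q \<in> poly_over A \<Longrightarrow> p * q \<in> poly_over A"
  by (simp add: poly_over_def coeff_mult subring_sum subring_mult)

lemma poly_over_monom: "is_subring A \<Longrightarrow> c \<in> A \<Longrightarrow> monom c n \<in> poly_over A"
  by (simp add: poly_over_def subring_0)

lemma poly_over_sum:
  "is_subring A \<Longrightarrow> (\<And>i. i \<in> I \<Longrightarrow> f i \<in> poly_over A) \<Longrightarrow> sum f I \<in> poly_over A"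
  by (induction I rule: infinite_finite_induct) (auto simp: poly_over_0 poly_over_add)

lemma poly_in_subring: "is_subring A \<Longrightarrow> p \<in> poly_over A \<Longrightarrow> x \<in> A \<Longrightarrow> poly p x \<in> A"
  by (induction p) (auto simp: poly_over_pCons_iff subring_add subring_mult subring_0)

lemma subring_ring_adjoin:
  assumes "is_subring A"
  shows "is_subring (ring_adjoin A x)"
  unfolding is_subring_def
proof (intro conjI ballI)
  show "0 \<in> ring_adjoin A x"
    unfolding ring_adjoin_def using poly_over_0[OF assms] by force
  show "1 \<in> ring_adjoin A x"
    unfolding ring_adjoin_def
    by (rule image_eqI[of _ _ "monom 1 0"])
      (use poly_over_monom[OF assms subring_1[OF assms], of 0] in \<open>auto simp: poly_monom\<close>)
next
  fix a b assume "a \<in> ring_adjoin A x" "b \<in> ring_adjoin A x"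
  then obtain p q where "p \<in> poly_over A" "q \<in> poly_over A" "a = poly p x" "b = poly q x"
    by (auto simp: ring_adjoin_def)
  then show "a + b \<in> ring_adjoin A x" "a * b \<in> ring_adjoin A x"
    unfolding ring_adjoin_def using poly_over_add[OF assms] poly_over_mult[OF assms]
    by (force, force)
next
  fix a assume "a \<in> ring_adjoin A x"
  then show "- a \<in> ring_adjoin A x"
    unfolding ring_adjoin_def using poly_over_uminus[OF assms] by force
qed

lemma subset_ring_adjoin: "is_subring A \<Longrightarrow> A \<subseteq> ring_adjoin A x"
  unfolding ring_adjoin_def
  by (auto intro!: image_eqI[of _ _ "[:a:]" for a] simp: poly_over_pCons_iff poly_over_0)

lemma self_in_ring_adjoin: "is_subring A \<Longrightarrow> x \<in> ring_adjoin A x"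
  unfolding ring_adjoin_def
  by (rule image_eqI[of _ _ "[:0, 1:]"]) (auto simp: poly_over_pCons_iff poly_over_0 subring_0 subring_1)

lemma ring_adjoin_least:
  "is_subring S \<Longrightarrow> A \<subseteq> S \<Longrightarrow> x \<in> S \<Longrightarrow> ring_adjoin A x \<subseteq> S"
  unfolding ring_adjoin_def using poly_in_subring poly_over_mono by blast

context
  fixes A :: "'a::comm_ring_1 set" and f :: "'a \<Rightarrow> 'b::comm_ring_1"
  assumes A: "is_subring A" and f: "hom_on A f"
begin

lemma hom_on_1: "f 1 = 1"
  and hom_on_add: "x \<in> A \<Longrightarrow> y \<in> A \<Longrightarrow> f (x + y) = f x + f y"
  and hom_on_mult: "x \<in> A \<Longrightarrow> y \<in> A \<Longrightarrow> f (x * y) = f x * f y"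
  using f by (auto simp: hom_on_def)

lemma hom_on_0: "f 0 = 0"
  using hom_on_add[of 0 0] subring_0[OF A] by simp

lemma hom_on_uminus: "x \<in> A \<Longrightarrow> f (- x) = - f x"
  using hom_on_add[of x "- x"] subring_uminus[OF A] hom_on_0
  by (simp add: eq_neg_iff_add_eq_0 add.commute)

lemma hom_on_diff: "x \<in> A \<Longrightarrow> y \<in> A \<Longrightarrow> f (x - y) = f x - f y"
  using hom_on_add[of x "- y"] hom_on_uminus[of y] subring_uminus[OF A] by simp

lemma hom_on_sum: "(\<And>i. i \<in> I \<Longrightarrow> g i \<in> A) \<Longrightarrow> f (sum g I) = (\<Sum>i\<in>I. f (g i))"
  by (induction I rule: infinite_finite_induct) (auto simp: hom_on_0 hom_on_add subring_sum[OF A])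

lemma hom_on_of_nat: "f (of_nat n) = of_nat n"
  by (induction n) (auto simp: hom_on_0 hom_on_add hom_on_1 subring_of_nat[OF A] subring_1[OF A])

lemma hom_on_of_int: "f (of_int n) = of_int n"
proof (cases n)
  case (nonneg k)
  then show ?thesis by (simp add: hom_on_of_nat)
next
  case (neg k)
  have "f (- of_nat (Suc k)) = - of_nat (Suc k)"
    by (subst hom_on_uminus) (simp_all only: hom_on_of_nat subring_of_nat[OF A])
  then show ?thesis using neg by simp
qed

lemma map_poly_hom_on_add:
  "p \<in> poly_over A \<Longrightarrow> q \<in> poly_over A \<Longrightarrow> map_poly f (p + q) = map_poly f p + map_poly f q"
  by (rule poly_eqI) (simp add: coeff_map_poly hom_on_0 poly_over_def hom_on_add)

lemma map_poly_hom_on_diff: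
  "p \<in> poly_over A \<Longrightarrow> q \<in> poly_over A \<Longrightarrow> map_poly f (p - q) = map_poly f p - map_poly f q"
  by (rule poly_eqI) (simp add: coeff_map_poly hom_on_0 poly_over_def hom_on_diff)

lemma map_poly_hom_on_mult:
  "p \<in> poly_over A \<Longrightarrow> q \<in> poly_over A \<Longrightarrow> map_poly f (p * q) = map_poly f p * map_poly f q"
  by (rule poly_eqI)
    (simp add: coeff_map_poly hom_on_0 poly_over_def coeff_mult hom_on_sum hom_on_mult subring_mult[OF A])

lemma hom_on_poly:
  "p \<in> poly_over A \<Longrightarrow> x \<in> A \<Longrightarrow> f (poly p x) = poly (map_poly f p) (f x)"
  by (induction p)
    (auto simp: poly_over_pCons_iff hom_on_0 hom_on_add hom_on_mult map_poly_pCons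
      subring_mult[OF A] poly_in_subring[OF A])

text \<open>The universal property of A[x]: every relation of x must hold for y. For transcendental
  x there is nothing to check; for x algebraic over a field the minimal polynomial suffices.\<close>

lemma hom_on_extend:
  assumes ker: "\<And>p. p \<in> poly_over A \<Longrightarrow> poly p x = 0 \<Longrightarrow> poly (map_poly f p) y = 0"
  obtains g where "hom_on (ring_adjoin A x) g" "\<And>a. a \<in> A \<Longrightarrow> g a = f a" "g x = y"
    "\<And>p. p \<in> poly_over A \<Longrightarrow> g (poly p x) = poly (map_poly f p) y"
proof -
  \<comment> \<open>Evaluates a chosen representing polynomial; two choices differ by a relation of
    x, which \<open>ker\<close> sends to 0.\<close>
  define g where "g = (\<lambda>z. poly (map_poly f (SOME p. p \<in> poly_over A \<and> poly p x = z)) y)"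
  have g: "g (poly p x) = poly (map_poly f p) y" if p: "p \<in> poly_over A" for p
  proof -
    define q where "q = (SOME q. q \<in> poly_over A \<and> poly q x = poly p x)"
    have q: "q \<in> poly_over A \<and> poly q x = poly p x"
      unfolding q_def by (rule someI[of _ p]) (use p in simp)
    have "poly (map_poly f (q - p)) y = 0"
      using q p by (intro ker poly_over_diff[OF A]) auto
    then show ?thesis using q p by (simp add: g_def q_def[symmetric] map_poly_hom_on_diff)
  qed
  have ga: "g a = f a" if "a \<in> A" for a
    using g[of "[:a:]"] that by (simp add: poly_over_pCons_iff poly_over_0[OF A] map_poly_pCons hom_on_0)
  have gx: "g x = y"
    using g[of "[:0, 1:]"]
    by (simp add: poly_over_pCons_iff poly_over_0[OF A] map_poly_pCons hom_on_0 hom_on_1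
        subring_0[OF A] subring_1[OF A])
  have "hom_on (ring_adjoin A x) g"
    unfolding hom_on_def
  proof (intro conjI ballI)
    show "g 1 = 1" using ga[OF subring_1[OF A]] hom_on_1 by simp
    fix u v assume "u \<in> ring_adjoin A x" "v \<in> ring_adjoin A x"
    then obtain p q where pq: "p \<in> poly_over A" "q \<in> poly_over A" "u = poly p x" "v = poly q x"
      by (auto simp: ring_adjoin_def)
    show "g (u + v) = g u + g v"
      using g[of "p + q"] pq by (simp add: g map_poly_hom_on_add poly_over_add[OF A])
    show "g (u * v) = g u * g v"
      using g[of "p * q"] pq by (simp add: g map_poly_hom_on_mult poly_over_mult[OF A])
  qed
  then show thesis using ga gx g that by blast
qed

end

lemma poly_over_division:
  assumes F: "is_subfield F" and m: "m \<in> poly_over F" "m \<noteq> 0" and "p \<in> poly_over F"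
  shows "\<exists>q\<in>poly_over F. \<exists>r\<in>poly_over F. p = q * m + r \<and> (r = 0 \<or> degree r < degree m)"
  using \<open>p \<in> poly_over F\<close>
\<comment> \<open>The length of the coefficient list tells 0 from the nonzero constants, which the
  degree does not.\<close>
proof (induction "length (coeffs p)" arbitrary: p rule: less_induct)
  case less
  note R = is_subfield_imp_subring[OF F]
  show ?case
  proof (cases "p = 0 \<or> degree p < degree m")
    case True
    then show ?thesis using less.prems poly_over_0[OF R] by (intro bexI[of _ 0] bexI[of _ p]) auto
  next
    case False
    define c where "c = lead_coeff p / lead_coeff m"
    define k where "k = degree p - degree m"
    have c: "c \<in> F" using less.prems m unfolding c_def poly_over_def
      by (intro subfield_divide[OF F]) auto
    define p' where "p' = p - monom c k * m"
    have p': "p' \<in> poly_over F"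
      unfolding p'_def using less.prems m c
      by (intro poly_over_diff[OF R] poly_over_mult[OF R] poly_over_monom[OF R])
    have z: "coeff p' i = 0" if "i \<ge> degree p" for i
    proof (cases "i = degree p")
      case True
      have "coeff (monom c k * m) (degree p) = c * lead_coeff m"
        using False by (simp add: coeff_monom_mult k_def)
      then show ?thesis using True m by (simp add: p'_def c_def)
    next
      case ne: False
      have "degree (monom c k * m) \<le> degree p"
        using degree_mult_le[of "monom c k" m] degree_monom_le[of c k] False by (auto simp: k_def)
      then show ?thesis using that ne by (simp add: p'_def coeff_eq_0)
    qed
    have "length (coeffs p') < length (coeffs p)"
    proof (cases "p' = 0")
      case True
      then show ?thesis using False by (simp add: length_coeffs)
    next
      case ne: False
      then have "degree p' < degree p" using z by (meson leading_coeff_0_iff not_le)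
      then show ?thesis using ne False by (simp add: length_coeffs)
    qed
    from less.hyps[OF this p'] obtain q r where qr: "q \<in> poly_over F" "r \<in> poly_over F"
      "p' = q * m + r" "r = 0 \<or> degree r < degree m" by blast
    have "p = (q + monom c k) * m + r" using qr(3) by (simp add: p'_def algebra_simps)
    then show ?thesis using qr c
      by (intro bexI[of _ "q + monom c k"] bexI[of _ r]) (auto intro!: poly_over_add[OF R] poly_over_monom[OF R])
  qed
qed

lemma minimal_polynomial_over:
  assumes F: "is_subfield F" and "alg_over F x"
  obtains m where "m \<in> poly_over F" "m \<noteq> 0" "poly m x = 0" "degree m > 0"
    "\<And>p. p \<in> poly_over F \<Longrightarrow> poly p x = 0 \<Longrightarrow> \<exists>q\<in>poly_over F. p = q * m"
    "\<And>p. p \<in> poly_over F \<Longrightarrow> poly p x = 0 \<Longrightarrow> degree p < degree m \<Longrightarrow> p = 0"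
proof -
  define Q where "Q = (\<lambda>m. m \<in> poly_over F \<and> m \<noteq> 0 \<and> poly m x = 0)"
  have "\<exists>m. Q m" using assms(2) unfolding alg_over_def Q_def by blast
  then obtain m where m: "Q m" "\<And>p. Q p \<Longrightarrow> degree m \<le> degree p"
    using ex_has_least_nat[of Q _ degree] by metis
  have mm: "m \<in> poly_over F" "m \<noteq> 0" "poly m x = 0" using m(1) by (auto simp: Q_def)
  have small: "p = 0" if "p \<in> poly_over F" "poly p x = 0" "degree p < degree m" for p
    using m(2)[of p] that unfolding Q_def by force
  have div: "\<exists>q\<in>poly_over F. p = q * m" if p: "p \<in> poly_over F" "poly p x = 0" for p
  proof -
    obtain q r where qr: "q \<in> poly_over F" "r \<in> poly_over F" "p = q * m + r"
      "r = 0 \<or> degree r < degree m" using poly_over_division[OF F mm(1,2) p(1)] by blast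
    have "poly r x = 0" using p(2) qr(3) mm(3) by simp
    then have "r = 0" using qr small by blast
    then show ?thesis using qr by auto
  qed
  have "degree m > 0"
  proof (rule ccontr)
    assume "\<not> degree m > 0"
    then obtain c where "m = [:c:]" by (metis degree_eq_zeroE neq0_conv)
    then show False using mm by simp
  qed
  then show thesis using that mm div small by blast
qed

text \<open>The powers of y form a sequence whose shifts lie in the span of the sequences b * y^n.
  So they satisfy a recurrence over F, and its instance at n = 0 is an algebraic equation for
  y.\<close>

lemma powers_in_span_imp_alg_over:
  fixes F :: "'a::field set"
  assumes F: "is_subfield F" and B: "finite B"
    and pow: "\<And>k. \<exists>c. (\<forall>b\<in>B. c b \<in> F) \<and> y ^ k = (\<Sum>b\<in>B. c b * b)"
  shows "alg_over F y"
proof -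
  note R = is_subfield_imp_subring[OF F]
  define B' where "B' = (\<lambda>b n. b * y ^ n) ` B"
  have "(\<lambda>n. y ^ (n + k)) \<in> seq_span F B'" for k
  proof -
    from pow[of k] obtain c where c: "\<forall>b\<in>B. c b \<in> F" "y ^ k = (\<Sum>b\<in>B. c b * b)" by blast
    have "(\<lambda>n. y ^ (n + k)) = (\<lambda>n. \<Sum>b\<in>B. c b * (b * y ^ n))"
      by (simp add: power_add c(2) sum_distrib_left mult_ac)
    also have "\<dots> \<in> seq_span F B'"
      by (intro seq_span_lincomb[OF R] seq_span_base[OF R]) (use B c in \<open>auto simp: B'_def\<close>)
    finally show ?thesis .
  qed
  then have "fin_rec F (\<lambda>n. y ^ n)" unfolding fin_rec_def using B by (intro exI[of _ B']) (auto simp: B'_def)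
  then have "lin_rec F (\<lambda>n. y ^ n)" using F by (simp add: lin_rec_iff_fin_rec)
  then obtain D c where c: "\<forall>i\<le>D. c i \<in> F" "\<exists>i\<le>D. c i \<noteq> 0" "\<And>n. (\<Sum>i\<le>D. c i * y ^ (n + i)) = 0"
    unfolding lin_rec_def by blast
  define p where "p = (\<Sum>i\<le>D. monom (c i) i)"
  have "p \<in> poly_over F" unfolding p_def using c(1)
    by (intro poly_over_sum[OF R] poly_over_monom[OF R]) auto
  moreover have "poly p y = 0" using c(3)[of 0] by (simp add: p_def poly_sum poly_monom)
  moreover have "p \<noteq> 0"
  proof -
    from c(2) obtain i where i: "i \<le> D" "c i \<noteq> 0" by blast
    have "coeff p i = c i" using i by (simp add: p_def coeff_sum)
    then show ?thesis using i by auto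
  qed
  ultimately show ?thesis unfolding alg_over_def by blast
qed

text \<open>Divide the equation by y until the constant term a is nonzero; then a + y * p(y) = 0
  displays the inverse as - p(y) / a.\<close>

lemma inverse_in_subring_of_alg_over:
  fixes F :: "'a::field set"
  assumes F: "is_subfield F" and S: "is_subring S" "F \<subseteq> S" "y \<in> S" and "y \<noteq> 0"
    and "alg_over F y"
  shows "inverse y \<in> S"
proof -
  have "inverse y \<in> S" if "p \<in> poly_over F" "p \<noteq> 0" "poly p y = 0" for p
    using that
  proof (induction p)
    case (pCons a p)
    then have ap: "a \<in> F" "p \<in> poly_over F" by (auto simp: poly_over_pCons_iff)
    show ?case
    proof (cases "a = 0")
      case True
      then show ?thesis using pCons ap \<open>y \<noteq> 0\<close> by auto
    next
      case False
      have "a + y * poly p y = 0" using pCons.prems by simp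
      then have "y * (- poly p y / a) = 1" using False by (simp add: field_simps neg_eq_iff_add_eq_0 add.commute)
      then have "inverse y = - poly p y * inverse a" by (simp add: inverse_unique divide_inverse)
      moreover have "poly p y \<in> S" using ap S poly_over_mono[OF S(2)] by (intro poly_in_subring) auto
      moreover have "inverse a \<in> S" using ap subfield_inverse[OF F] S by auto
      ultimately show ?thesis using S(1) by (simp add: subring_mult subring_uminus)
    qed
  qed simp
  then show ?thesis using assms(6) unfolding alg_over_def by blast
qed

text \<open>The power basis, with d the degree of the minimal polynomial: remainders give spanning,
  minimality gives independence.\<close>

lemma ring_adjoin_coordinates:
  fixes F :: "'a::field set"
  assumes F: "is_subfield F" and "alg_over F x"
  obtains d where
    "\<And>y. y \<in> ring_adjoin F x \<Longrightarrow> \<exists>c. (\<forall>l<d. c l \<in> F) \<and> y = (\<Sum>l<d. c l * x ^ l)"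
    "\<And>c. (\<And>l. l < d \<Longrightarrow> c l \<in> F) \<Longrightarrow> (\<Sum>l<d. c l * x ^ l) = 0 \<Longrightarrow> \<forall>l<d. c l = 0"
proof -
  note R = is_subfield_imp_subring[OF F]
  obtain m where m: "m \<in> poly_over F" "m \<noteq> 0" "poly m x = 0" "degree m > 0"
    "\<And>p. p \<in> poly_over F \<Longrightarrow> poly p x = 0 \<Longrightarrow> \<exists>q\<in>poly_over F. p = q * m"
    "\<And>p. p \<in> poly_over F \<Longrightarrow> poly p x = 0 \<Longrightarrow> degree p < degree m \<Longrightarrow> p = 0"
    using minimal_polynomial_over[OF assms] by blast
  show thesis
  proof
    fix y assume "y \<in> ring_adjoin F x"
    then obtain p where p: "p \<in> poly_over F" "y = poly p x" by (auto simp: ring_adjoin_def)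
    obtain q r where qr: "q \<in> poly_over F" "r \<in> poly_over F" "p = q * m + r"
      "r = 0 \<or> degree r < degree m" using poly_over_division[OF F m(1,2) p(1)] by blast
    have dr: "degree r < degree m" using qr(4) m(4) by auto
    have "y = poly r x" using p(2) qr(3) m(3) by simp
    also have "\<dots> = (\<Sum>l\<le>degree r. coeff r l * x ^ l)" by (simp add: poly_altdef)
    also have "\<dots> = (\<Sum>l<degree m. coeff r l * x ^ l)"
      by (rule sum.mono_neutral_left) (use dr in \<open>auto simp: coeff_eq_0\<close>)
    finally show "\<exists>c. (\<forall>l<degree m. c l \<in> F) \<and> y = (\<Sum>l<degree m. c l * x ^ l)"
      using qr(2) by (intro exI[of _ "coeff r"]) (auto simp: poly_over_def)
  next
    fix c assume c: "\<And>l. l < degree m \<Longrightarrow> c l \<in> F" "(\<Sum>l<degree m. c l * x ^ l) = 0"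
    define p where "p = (\<Sum>l<degree m. monom (c l) l)"
    have cp: "coeff p i = (if i < degree m then c i else 0)" for i
      by (simp add: p_def coeff_sum)
    have "p \<in> poly_over F" unfolding p_def using c(1)
      by (intro poly_over_sum[OF R] poly_over_monom[OF R]) auto
    moreover have "poly p x = 0" using c(2) by (simp add: p_def poly_sum poly_monom)
    moreover have "degree p < degree m"
      using m(4) cp by (metis degree_0 leading_coeff_0_iff)
    ultimately have "p = 0" using m(6) by blast
    then show "\<forall>l<degree m. c l = 0" using cp by (metis coeff_0)
  qed
qed

lemma subfield_ring_adjoin:
  fixes F :: "'a::field set"
  assumes F: "is_subfield F" and "alg_over F x"
  shows "is_subfield (ring_adjoin F x)"
proof (rule is_subfieldI)
  note R = is_subfield_imp_subring[OF F]
  show S: "is_subring (ring_adjoin F x)" by (rule subring_ring_adjoin[OF R])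
  fix y assume y: "y \<in> ring_adjoin F x" "y \<noteq> 0"
  obtain d where d: "\<And>y. y \<in> ring_adjoin F x \<Longrightarrow> \<exists>c. (\<forall>l<d. c l \<in> F) \<and> y = (\<Sum>l<d. c l * x ^ l)"
    "\<And>c. (\<And>l. l < d \<Longrightarrow> c l \<in> F) \<Longrightarrow> (\<Sum>l<d. c l * x ^ l) = 0 \<Longrightarrow> \<forall>l<d. c l = 0"
    using ring_adjoin_coordinates[OF assms] by blast
  have inj: "inj_on (\<lambda>l. x ^ l) {..<d}"
  proof (rule inj_onI, rule ccontr)
    fix i j assume ij: "i \<in> {..<d}" "j \<in> {..<d}" "x ^ i = x ^ j" "i \<noteq> j"
    define c where "c = (\<lambda>l. if l = i then 1 else if l = j then - 1 else 0 :: 'a)"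
    have "(\<Sum>l<d. c l * x ^ l) = (\<Sum>l\<in>{i, j}. c l * x ^ l)"
      by (rule sum.mono_neutral_right) (use ij in \<open>auto simp: c_def\<close>)
    also have "\<dots> = 0" using ij by (simp add: c_def)
    finally have "\<forall>l<d. c l = 0"
      by (intro d(2)) (use R in \<open>auto simp: c_def subring_0 subring_1 subring_uminus\<close>)
    then have "c i = 0" using ij by blast
    then show False by (simp add: c_def)
  qed
  have "alg_over F y"
  proof (rule powers_in_span_imp_alg_over[OF F])
    fix k
    have "y ^ k \<in> ring_adjoin F x" using y S by (intro subring_power)
    then obtain c where c: "\<forall>l<d. c l \<in> F" "y ^ k = (\<Sum>l<d. c l * x ^ l)" using d(1) by blast
    \<comment> \<open>Moves the coordinates from exponents to the powers themselves, since the span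
      criterion sums over a set of elements.\<close>
    define e where "e = (\<lambda>b. c (the_inv_into {..<d} (\<lambda>l. x ^ l) b))"
    have "e (x ^ l) = c l" if "l < d" for l
      using the_inv_into_f_f[OF inj] that by (simp add: e_def)
    then show "\<exists>c. (\<forall>b\<in>(\<lambda>l. x ^ l) ` {..<d}. c b \<in> F) \<and> y ^ k = (\<Sum>b\<in>(\<lambda>l. x ^ l) ` {..<d}. c b * b)"
      using c by (intro exI[of _ e]) (auto simp: sum.reindex[OF inj])
  qed auto
  then show "inverse y \<in> ring_adjoin F x"
    using inverse_in_subring_of_alg_over[OF F S] subset_ring_adjoin[OF R] y by blast
qed

subsection \<open>The Skolem--Mahler--Lech theorem\<close>

lemma periodic_multiple:
  fixes b :: "nat \<Rightarrow> 'b"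
  assumes "\<And>n. n > N \<Longrightarrow> b (n + r) = b n" "n > N"
  shows "b (n + r * k) = b n"
proof (induction k)
  case (Suc k)
  have "b (n + r * Suc k) = b ((n + r * k) + r)" by (simp add: algebra_simps)
  also have "\<dots> = b (n + r * k)" by (rule assms(1)) (use assms(2) in simp)
  finally show ?case using Suc by simp
qed simp

lemma virtually_periodic_family:
  assumes "finite I" "\<And>i. i \<in> I \<Longrightarrow> virtually_periodic (b i)"
  shows "\<exists>N r. r > 0 \<and> (\<forall>i\<in>I. \<forall>n>N. b i (n + r) = b i n)"
  using assms
proof (induction I rule: finite_induct)
  case empty
  show ?case by (auto intro: exI[of _ 1])
next
  case (insert i I)
  then have "\<exists>N r. r > 0 \<and> (\<forall>j\<in>I. \<forall>n>N. b j (n + r) = b j n)" by simp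
  then obtain N r where r: "r > 0" "\<And>j n. j \<in> I \<Longrightarrow> n > N \<Longrightarrow> b j (n + r) = b j n" by blast
  from insert.prems[of i] obtain N' r' where r': "r' > 0" "\<And>n. n > N' \<Longrightarrow> b i (n + r') = b i n"
    by (auto simp: virtually_periodic_def)
  have "b j (n + r * r') = b j n" if "j \<in> insert i I" "n > max N N'" for j n
  proof (cases "j = i")
    case True
    then show ?thesis using periodic_multiple[of N' "b i" r' n r] r' that by (simp add: mult.commute)
  next
    case False
    then show ?thesis using periodic_multiple[of N "b j" r n r'] r that by simp
  qed
  then show ?case using r r' by (intro exI[of _ "max N N'"] exI[of _ "r * r'"]) auto
qed

lemma virtually_periodic_of_shift:
  assumes "virtually_periodic (\<lambda>n. b (n + N))"
  shows "virtually_periodic b"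
proof -
  from assms obtain M r where M: "r > 0" "\<And>n. n > M \<Longrightarrow> b (n + r + N) = b (n + N)"
    by (auto simp: virtually_periodic_def)
  have "b (n + r) = b n" if "n > M + N" for n
  proof -
    have "n - N > M" "n - N + r + N = n + r" "n - N + N = n" using that by auto
    then show ?thesis using M(2)[of "n - N"] by simp
  qed
  then show ?thesis using M(1) unfolding virtually_periodic_def by blast
qed

text \<open>On each class Z is eventually constant, false in the finite case and true otherwise; the
  r thresholds have a maximum.\<close>

lemma virtually_periodic_residue_classes:
  assumes r: "r > 0" and "\<And>j. finite {k. Z (j + r * k)} \<or> (\<forall>k. Z (j + r * k))"
  shows "virtually_periodic Z"
proof -
  have "\<exists>N. \<forall>k. k > N \<longrightarrow> Z (j + r * k) = Z (j + r * Suc k)" for j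
  proof (cases "\<forall>k. Z (j + r * k)")
    case True
    then show ?thesis by blast
  next
    case False
    then have "finite {k. Z (j + r * k)}" using assms(2) by blast
    then obtain N where "\<And>k. Z (j + r * k) \<Longrightarrow> k \<le> N"
      by (metis (mono_tags) Max_ge mem_Collect_eq)
    then show ?thesis by (intro exI[of _ N]) (metis le_SucI not_le less_SucI)
  qed
  then obtain N where N: "\<And>j k. k > N j \<Longrightarrow> Z (j + r * k) = Z (j + r * Suc k)" by metis
  define M where "M = Max (N ` {..<r})"
  have M: "N j \<le> M" if "j < r" for j unfolding M_def using that by (intro Max_ge) auto
  have "Z (n + r) = Z n" if "n > r * Suc M" for n
  proof -
    have n: "n = n mod r + r * (n div r)" by simp
    have "n div r \<ge> Suc M" using that r
      by (metis div_le_mono less_imp_le nonzero_mult_div_cancel_left neq0_conv)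
    then have "n div r > N (n mod r)" using M[of "n mod r"] r by (meson Suc_le_lessD le_less_trans mod_less_divisor)
    from N[OF this] show ?thesis using n by (metis add.assoc mult_Suc_right add.commute)
  qed
  then show ?thesis unfolding virtually_periodic_def using r by blast
qed

text \<open>Relativised to F, for values and coefficients alike, so that it can be carried up a
  tower of fields.\<close>

definition sml_on :: "'a::field set \<Rightarrow> bool" where
  "sml_on F \<longleftrightarrow> (\<forall>a. (\<forall>n. a n \<in> F) \<longrightarrow> lin_rec F a \<longrightarrow> virtually_periodic (\<lambda>n. a n = 0))"

text \<open>Restriction of scalars: the F[x]-span of B is the F-span of the x^l * b, so a satisfies
  a recurrence over F itself. By independence of the x^l each coordinate satisfies the same one, and
  a vanishes exactly where all coordinates do.\<close>

lemma sml_ring_adjoin: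
  assumes F: "is_subfield F" and "sml_on F" and x: "alg_over F x"
  shows "sml_on (ring_adjoin F x)"
  unfolding sml_on_def
proof (intro allI impI)
  fix a assume aE: "\<forall>n. a n \<in> ring_adjoin F x" and rec: "lin_rec (ring_adjoin F x) a"
  note R = is_subfield_imp_subring[OF F]
  obtain d where d: "\<And>y. y \<in> ring_adjoin F x \<Longrightarrow> \<exists>c. (\<forall>l<d. c l \<in> F) \<and> y = (\<Sum>l<d. c l * x ^ l)"
    "\<And>c. (\<And>l. l < d \<Longrightarrow> c l \<in> F) \<Longrightarrow> (\<Sum>l<d. c l * x ^ l) = 0 \<Longrightarrow> \<forall>l<d. c l = 0"
    using ring_adjoin_coordinates[OF F x] by blast
  from rec obtain B where B: "finite B" "\<And>k. (\<lambda>n. a (n + k)) \<in> seq_span (ring_adjoin F x) B"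
    using subfield_ring_adjoin[OF F x] by (auto simp: lin_rec_iff_fin_rec fin_rec_def)
  define B' where "B' = (\<lambda>(l, b) n. x ^ l * b n) ` ({..<d} \<times> B)"
  have B': "finite B'" using B by (simp add: B'_def)
  have "(\<lambda>n. a (n + k)) \<in> seq_span F B'" for k
  proof -
    from B(2)[of k] obtain c where c: "\<forall>b\<in>B. c b \<in> ring_adjoin F x"
      "\<And>n. a (n + k) = (\<Sum>b\<in>B. c b * b n)" by (auto simp: seq_span_def)
    from c(1) d(1) have "\<forall>b\<in>B. \<exists>e. (\<forall>l<d. e l \<in> F) \<and> c b = (\<Sum>l<d. e l * x ^ l)" by blast
    then obtain e where e: "\<And>b l. b \<in> B \<Longrightarrow> l < d \<Longrightarrow> e b l \<in> F"
      "\<And>b. b \<in> B \<Longrightarrow> c b = (\<Sum>l<d. e b l * x ^ l)" by metis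
    have "(\<lambda>n. a (n + k)) = (\<lambda>n. \<Sum>b\<in>B. \<Sum>l<d. e b l * (x ^ l * b n))"
      by (simp add: c(2) e(2) sum_distrib_right mult.assoc)
    also have "\<dots> \<in> seq_span F B'"
      by (intro seq_span_sum[OF R] seq_span_lincomb[OF R] seq_span_base[OF R B'])
        (use e in \<open>auto simp: B'_def\<close>)
    finally show ?thesis .
  qed
  then have "fin_rec F a" using B' unfolding fin_rec_def by blast
  then have "lin_rec F a" using F by (simp add: lin_rec_iff_fin_rec)
  then obtain D c where c: "\<forall>i\<le>D. c i \<in> F" "\<exists>i\<le>D. c i \<noteq> 0" "\<And>n. (\<Sum>i\<le>D. c i * a (n + i)) = 0"
    by (auto simp: lin_rec_def)
  have "\<forall>n. \<exists>e. (\<forall>l<d. e l \<in> F) \<and> a n = (\<Sum>l<d. e l * x ^ l)" using aE d(1) by blast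
  then obtain t where t: "\<And>n l. l < d \<Longrightarrow> t n l \<in> F" "\<And>n. a n = (\<Sum>l<d. t n l * x ^ l)" by metis
  have "virtually_periodic (\<lambda>n. t n l = 0)" if l: "l < d" for l
  proof -
    have "(\<Sum>i\<le>D. c i * t (n + i) l) = 0" for n
    proof -
      have "(\<Sum>l<d. (\<Sum>i\<le>D. c i * t (n + i) l) * x ^ l) = (\<Sum>l<d. \<Sum>i\<le>D. c i * (t (n + i) l * x ^ l))"
        by (simp add: sum_distrib_right mult.assoc)
      also have "\<dots> = (\<Sum>i\<le>D. c i * a (n + i))"
        by (subst sum.swap) (simp add: t(2) sum_distrib_left)
      finally have "(\<Sum>l<d. (\<Sum>i\<le>D. c i * t (n + i) l) * x ^ l) = 0" using c(3) by simp
      then have "\<forall>l<d. (\<Sum>i\<le>D. c i * t (n + i) l) = 0"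
        by (rule d(2)[rotated]) (use c(1) t(1) in \<open>auto intro!: subring_sum[OF R] subring_mult[OF R]\<close>)
      then show ?thesis using l by blast
    qed
    then have "lin_rec F (\<lambda>n. t n l)" unfolding lin_rec_def using c by blast
    then show ?thesis
      using \<open>sml_on F\<close>[unfolded sml_on_def, rule_format, of "\<lambda>n. t n l"] t(1)[OF l] by blast
  qed
  then have "\<exists>N r. r > 0 \<and> (\<forall>l\<in>{..<d}. \<forall>n>N. (t (n + r) l = 0) = (t n l = 0))"
    by (intro virtually_periodic_family) auto
  then obtain N r where r: "r > 0" "\<And>l n. l \<in> {..<d} \<Longrightarrow> n > N \<Longrightarrow> (t (n + r) l = 0) = (t n l = 0)"
    by blast
  have zero: "a n = 0 \<longleftrightarrow> (\<forall>l<d. t n l = 0)" for n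
    using d(2)[of "t n"] t by auto
  show "virtually_periodic (\<lambda>n. a n = 0)"
    unfolding virtually_periodic_def
  proof (intro exI conjI allI impI)
    show "(a (n + r) = 0) = (a n = 0)" if "n > N" for n
      unfolding zero using r(2) that by auto
  qed (rule r(1))
qed

text \<open>Enough integer specialisations at which a prescribed element \<open>c\<close> stays a unit modulo one
  prime \<open>p\<close>, which must not depend on the element \<open>g\<close> to be kept nonzero.\<close>
definition specialisable :: "'a::comm_ring_1 set \<Rightarrow> bool" where
  "specialisable A \<longleftrightarrow> is_subring A \<and>
     (\<forall>c\<in>A. c \<noteq> 0 \<longrightarrow> (\<exists>p::nat. prime p \<and>
        (\<forall>g\<in>A. g \<noteq> 0 \<longrightarrow> (\<exists>h::'a \<Rightarrow> int. hom_on A h \<and> \<not> int p dvd h c \<and> h g \<noteq> 0))))"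

text \<open>One homomorphism, the inverse of \<open>of_int\<close>, serves every g; any prime above
  the absolute value of c will do.\<close>

lemma specialisable_Ints: "specialisable (\<int> :: 'a::field_char_0 set)"
proof -
  define h where "h = inv_into UNIV (of_int :: int \<Rightarrow> 'a)"
  have h: "h (of_int k) = k" for k unfolding h_def by (rule inv_into_f_f) (simp_all add: inj_def)
  have "hom_on \<int> h"
    unfolding hom_on_def
  proof (intro conjI ballI)
    show "h 1 = 1" using h[of 1] by simp
    fix x y :: 'a assume "x \<in> \<int>" "y \<in> \<int>"
    then obtain k l where kl: "x = of_int k" "y = of_int l" by (auto elim!: Ints_cases)
    show "h (x + y) = h x + h y" using h[of "k + l"] kl h by simp
    show "h (x * y) = h x * h y" using h[of "k * l"] kl h by simp
  qed
  moreover have "is_subring (\<int> :: 'a set)" by (auto simp: is_subring_def)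
  moreover have "\<exists>p::nat. prime p \<and> \<not> int p dvd h c" if c: "c \<in> \<int>" "c \<noteq> 0" for c
  proof -
    obtain k where k: "c = of_int k" "k \<noteq> 0" using c by (auto elim!: Ints_cases)
    obtain p where p: "prime p" "p > nat \<bar>k\<bar>" using bigger_prime by blast
    have "\<not> int p dvd k" using p(2) k(2) zdvd_imp_le[of "int p" "\<bar>k\<bar>"] by auto
    then show ?thesis using p k h by auto
  qed
  moreover have "h g \<noteq> 0" if "g \<in> \<int>" "g \<noteq> 0" for g
    using that h by (auto elim!: Ints_cases)
  ultimately show ?thesis unfolding specialisable_def by blast
qed

text \<open>A residue class modulo p is infinite in characteristic zero, so roots can be avoided
  without leaving it.\<close>

lemma poly_nonzero_at_int:
  fixes P :: "'a::field_char_0 poly"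
  assumes "P \<noteq> 0" "(p::int) \<noteq> 0"
  obtains t where "poly P (of_int (s + p * t)) \<noteq> 0"
proof -
  have "inj (\<lambda>t. of_int (s + p * t) :: 'a)" using assms(2) by (auto simp: inj_def)
  then have "infinite (range (\<lambda>t. of_int (s + p * t) :: 'a))"
    using finite_imageD infinite_UNIV_int by blast
  then have "\<not> range (\<lambda>t. of_int (s + p * t) :: 'a) \<subseteq> {x. poly P x = 0}"
    using poly_roots_finite[OF assms(1)] finite_subset by blast
  then show thesis using that by blast
qed

lemma poly_cong_mod:
  fixes P :: "int poly"
  assumes "p dvd x - y"
  shows "p dvd poly P x - poly P y"
proof -
  have "[poly P x = poly P y] (mod p)"
    using assms by (induction P) (auto simp: cong_iff_dvd_diff[symmetric] intro!: cong_add cong_mult)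
  then show ?thesis by (simp add: cong_iff_dvd_diff)
qed

text \<open>For c = C(x) fix an integer s with C(s) \<noteq> 0 and take the prime that A provides
  for C(s). For g = G(x) send x to some y congruent to s modulo p with G(y) \<noteq> 0. The
  congruence keeps the image of c prime to p; y depends on g, but p does not.\<close>

lemma specialisable_ring_adjoin:
  fixes x :: "'a::field_char_0"
  assumes A: "specialisable A" and x: "\<not> alg_over A x"
  shows "specialisable (ring_adjoin A x)"
  unfolding specialisable_def
proof (intro conjI ballI impI)
  from A have R: "is_subring A" by (simp add: specialisable_def)
  show "is_subring (ring_adjoin A x)" by (rule subring_ring_adjoin[OF R])
  fix c assume "c \<in> ring_adjoin A x" "c \<noteq> 0"
  then obtain C where C: "C \<in> poly_over A" "c = poly C x" "C \<noteq> 0"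
    unfolding ring_adjoin_def by (elim imageE) (metis poly_0)
  obtain s where s: "poly C (of_int s) \<noteq> 0" using poly_nonzero_at_int[OF C(3), of 1 0] by auto
  have "poly C (of_int s) \<in> A" using C R by (intro poly_in_subring subring_of_int)
  then obtain p :: nat where p: "prime p" "\<And>g. g \<in> A \<Longrightarrow> g \<noteq> 0 \<Longrightarrow>
      \<exists>h::'a \<Rightarrow> int. hom_on A h \<and> \<not> int p dvd h (poly C (of_int s)) \<and> h g \<noteq> 0"
    using A s unfolding specialisable_def by blast
  show "\<exists>p::nat. prime p \<and> (\<forall>g\<in>ring_adjoin A x. g \<noteq> 0 \<longrightarrow>
      (\<exists>h::'a \<Rightarrow> int. hom_on (ring_adjoin A x) h \<and> \<not> int p dvd h c \<and> h g \<noteq> 0))"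
  proof (intro exI[of _ p] conjI ballI impI p(1))
    fix g assume "g \<in> ring_adjoin A x" "g \<noteq> 0"
    then obtain G where G: "G \<in> poly_over A" "g = poly G x" "G \<noteq> 0"
      unfolding ring_adjoin_def by (elim imageE) (metis poly_0)
    obtain t where t: "poly G (of_int (s + int p * t)) \<noteq> 0"
      using poly_nonzero_at_int[OF G(3), of "int p" s] p(1) by auto
    define y where "y = s + int p * t"
    have "poly G (of_int y) \<in> A" using G R by (intro poly_in_subring subring_of_int)
    with p(2) t obtain h :: "'a \<Rightarrow> int" where h: "hom_on A h"
      "\<not> int p dvd h (poly C (of_int s))" "h (poly G (of_int y)) \<noteq> 0" unfolding y_def by blast
    have ev: "h (poly P (of_int k)) = poly (map_poly h P) k" if "P \<in> poly_over A" for P k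
      using hom_on_poly[OF R h(1) that subring_of_int[OF R]] hom_on_of_int[OF R h(1)] by simp
    \<comment> \<open>As x is transcendental its only relation is 0, so every y is allowed.\<close>
    have "poly (map_poly h P) y = 0" if "P \<in> poly_over A" "poly P x = 0" for P
    proof -
      have "P = 0" using x that unfolding alg_over_def by blast
      then show ?thesis by simp
    qed
    from hom_on_extend[OF R h(1), of x y, OF this] obtain h' where h': "hom_on (ring_adjoin A x) h'"
      "\<And>P. P \<in> poly_over A \<Longrightarrow> h' (poly P x) = poly (map_poly h P) y" by metis
    have "\<not> int p dvd h' c"
    proof
      assume "int p dvd h' c"
      then have "int p dvd poly (map_poly h C) y" using h'(2)[OF C(1)] C(2) by simp
      moreover have "int p dvd poly (map_poly h C) y - poly (map_poly h C) s"
        by (rule poly_cong_mod) (simp add: y_def)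
      ultimately have "int p dvd poly (map_poly h C) s" by (simp add: dvd_diff_right_iff dvd_diffD1)
      then show False using h(2) ev[OF C(1)] by simp
    qed
    moreover have "h' g \<noteq> 0" using h'(2)[OF G(1)] G(2) h(3) ev[OF G(1)] by simp
    ultimately show "\<exists>h::'a \<Rightarrow> int. hom_on (ring_adjoin A x) h \<and> \<not> int p dvd h c \<and> h g \<noteq> 0"
      using h'(1) by blast
  qed
qed

lemma alg_over_self: "is_subring A \<Longrightarrow> x \<in> A \<Longrightarrow> alg_over A x"
  unfolding alg_over_def
  by (rule bexI[of _ "[:- x, 1:]"]) (auto simp: poly_over_pCons_iff poly_over_0 subring_uminus subring_1)

text \<open>A transcendence basis chosen greedily from G: an element is adjoined only if it is
  transcendental over the ring reached so far, which keeps A a polynomial ring over the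
  integers.\<close>

lemma ex_specialisable_alg_over:
  fixes G :: "'a::field_char_0 set"
  assumes "finite G"
  shows "\<exists>A. specialisable A \<and> (\<forall>x\<in>G. alg_over A x)"
  using assms
proof (induction G rule: finite_induct)
  case empty
  show ?case using specialisable_Ints by blast
next
  case (insert x G)
  then obtain A where A: "specialisable A" "\<forall>x\<in>G. alg_over A x" by blast
  show ?case
  proof (cases "alg_over A x")
    case True
    then show ?thesis using A by blast
  next
    case False
    have R: "is_subring A" using A by (simp add: specialisable_def)
    have "alg_over (ring_adjoin A x) x"
      by (rule alg_over_self[OF subring_ring_adjoin[OF R] self_in_ring_adjoin[OF R]])
    moreover have "\<forall>y\<in>G. alg_over (ring_adjoin A x) y"
      using A alg_over_mono[OF subset_ring_adjoin[OF R]] by blast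
    ultimately show ?thesis using specialisable_ring_adjoin[OF A(1) False] by blast
  qed
qed

section \<open>Quotient fields and clearing denominators\<close>

definition quot_field :: "'a::field set \<Rightarrow> 'a set" where
  "quot_field A = {u / v | u v. u \<in> A \<and> v \<in> A \<and> v \<noteq> 0}"

lemma quot_fieldI: "u \<in> A \<Longrightarrow> v \<in> A \<Longrightarrow> v \<noteq> 0 \<Longrightarrow> u / v \<in> quot_field A"
  unfolding quot_field_def by blast

lemma subfield_quot_field:
  assumes R: "is_subring A"
  shows "is_subfield (quot_field A)"
  unfolding is_subfield_def
proof (intro conjI ballI)
  have "u \<in> quot_field A" if "u \<in> A" for u
    using quot_fieldI[OF that subring_1[OF R]] by simp
  then show "0 \<in> quot_field A" "1 \<in> quot_field A"
    using subring_0[OF R] subring_1[OF R] by auto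
next
  fix x y assume "x \<in> quot_field A" "y \<in> quot_field A"
  then obtain u v u' v' where *: "x = u / v" "y = u' / v'" "u \<in> A" "v \<in> A" "v \<noteq> 0"
    "u' \<in> A" "v' \<in> A" "v' \<noteq> 0" by (auto simp: quot_field_def)
  have "x + y = (u * v' + u' * v) / (v * v')" using * by (simp add: field_simps)
  moreover have "x * y = (u * u') / (v * v')" using * by simp
  moreover have "v * v' \<in> A" "v * v' \<noteq> 0" "u * v' + u' * v \<in> A" "u * u' \<in> A"
    using * R by (auto intro!: subring_add subring_mult)
  ultimately show "x + y \<in> quot_field A" "x * y \<in> quot_field A"
    unfolding quot_field_def by blast+
next
  fix x assume "x \<in> quot_field A"
  then obtain u v where *: "x = u / v" "u \<in> A" "v \<in> A" "v \<noteq> 0" by (auto simp: quot_field_def)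
  have "- x = (- u) / v" using * by simp
  then show "- x \<in> quot_field A"
    using * subring_uminus[OF R] unfolding quot_field_def by blast
  show "inverse x \<in> quot_field A"
  proof (cases "u = 0")
    case True
    then show ?thesis using * unfolding quot_field_def by auto
  next
    case False
    have "inverse x = v / u" using * by simp
    then show ?thesis using * False unfolding quot_field_def by blast
  qed
qed

lemma subset_quot_field: "is_subring A \<Longrightarrow> A \<subseteq> quot_field A"
  using quot_fieldI[of _ A 1] subring_1 by fastforce

lemma common_denominator:
  assumes R: "is_subring A" and "finite G" "G \<subseteq> quot_field A"
  shows "\<exists>D\<in>A. D \<noteq> 0 \<and> (\<forall>x\<in>G. D * x \<in> A)"
  using assms(2,3)
proof (induction G rule: finite_induct)
  case empty
  show ?case using subring_1[OF R] by (intro bexI[of _ 1]) auto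
next
  case (insert x G)
  then obtain D where D: "D \<in> A" "D \<noteq> 0" "\<forall>x\<in>G. D * x \<in> A" by auto
  from insert.prems obtain u v where uv: "x = u / v" "u \<in> A" "v \<in> A" "v \<noteq> 0"
    by (auto simp: quot_field_def)
  have "v * D * x = u * D" using uv by simp
  moreover have "v * D * y \<in> A" if "y \<in> G" for y
    using D uv that subring_mult[OF R, of v "D * y"] by (simp add: mult.assoc)
  ultimately show ?case
    using D uv R by (intro bexI[of _ "v * D"]) (auto intro!: subring_mult)
qed

text \<open>A nonzero value on a residue class that contains infinitely many zeros would survive under
  some specialisation, against the integer case; the modulus depends only on \<open>p\<close> and \<open>d\<close>.\<close>
lemma specialisable_recurrence_zeros:
  fixes a c :: "nat \<Rightarrow> 'a::field_char_0"
  assumes A: "specialisable A" and d: "d > 0"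
    and c: "\<And>i. i < d \<Longrightarrow> c i \<in> A" "c 0 \<noteq> 0" and aA: "\<And>n. a n \<in> A"
    and rec: "\<And>n. a (n + d) = (\<Sum>i<d. c i * a (n + i))"
  shows "virtually_periodic (\<lambda>n. a n = 0)"
proof -
  have R: "is_subring A" using A by (simp add: specialisable_def)
  obtain p :: nat where p: "prime p" "\<And>g. g \<in> A \<Longrightarrow> g \<noteq> 0 \<Longrightarrow>
      \<exists>h::'a \<Rightarrow> int. hom_on A h \<and> \<not> int p dvd h (c 0) \<and> h g \<noteq> 0"
    using A c(1)[OF d] c(2) unfolding specialisable_def by blast
  define r :: nat where "r = fact ((p\<^sup>2) ^ d)"
  show ?thesis
  proof (rule virtually_periodic_residue_classes[of r])
    fix j
    show "finite {k. a (j + r * k) = 0} \<or> (\<forall>k. a (j + r * k) = 0)"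
    proof (rule ccontr)
      assume "\<not> ?thesis"
      then obtain k0 where inf: "infinite {k. a (j + r * k) = 0}" and k0: "a (j + r * k0) \<noteq> 0" by blast
      obtain h :: "'a \<Rightarrow> int" where h: "hom_on A h" "\<not> int p dvd h (c 0)" "h (a (j + r * k0)) \<noteq> 0"
        using p(2)[OF aA k0] by blast
      have "h (a (j + r * k0)) = 0"
        unfolding r_def
      proof (rule int_recurrence_infinite_zeros[OF p(1) d])
        show "\<not> int p dvd (\<lambda>i. h (c i)) 0" using h(2) .
        show "h (a (n + d)) = (\<Sum>i<d. h (c i) * h (a (n + i)))" for n
        proof -
          have "h (a (n + d)) = (\<Sum>i<d. h (c i * a (n + i)))"
            unfolding rec by (rule hom_on_sum[OF R h(1)]) (use c(1) aA in \<open>auto intro!: subring_mult[OF R]\<close>)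
          also have "\<dots> = (\<Sum>i<d. h (c i) * h (a (n + i)))"
            by (rule sum.cong) (use c(1) aA in \<open>auto intro!: hom_on_mult[OF R h(1)]\<close>)
          finally show ?thesis .
        qed
        have "{k. a (j + r * k) = 0} \<subseteq> {k. h (a (j + r * k)) = 0}"
          using hom_on_0[OF R h(1)] by auto
        with inf show "infinite {k. h (a (j + fact ((p\<^sup>2) ^ d) * k)) = 0}"
          unfolding r_def using finite_subset by blast
      qed
      with h(3) show False by contradiction
    qed
  qed (simp add: r_def)
qed

text \<open>Dropping the first N terms, where c 0, ..., c (N - 1) are the vanishing initial
  coefficients, makes the recurrence reversible.\<close>

lemma lin_rec_invertible:
  assumes F: "is_subfield F" and "lin_rec F a"
  obtains N d c where "\<forall>i<d. c i \<in> F" "d > 0 \<longrightarrow> c 0 \<noteq> 0"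
    "\<forall>n. a (n + d + N) = (\<Sum>i<d. c i * a (n + i + N))"
proof -
  obtain d c where c: "\<And>i. i < d \<Longrightarrow> c i \<in> F" and rec: "\<And>n. a (n + d) = (\<Sum>i<d. c i * a (n + i))"
    using lin_rec_leading[OF assms] by blast
  \<comment> \<open>If all coefficients vanish, N = d leaves a recurrence of order 0, which says
    that all terms from d on are 0.\<close>
  define N where "N = (if \<exists>i<d. c i \<noteq> 0 then LEAST i. i < d \<and> c i \<noteq> 0 else d)"
  have N: "N \<le> d" "\<And>i. i < N \<Longrightarrow> c i = 0" "N < d \<Longrightarrow> c N \<noteq> 0"
  proof -
    show Nd: "N \<le> d"
      unfolding N_def using LeastI_ex[of "\<lambda>i. i < d \<and> c i \<noteq> 0"] by (auto intro: less_imp_le)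
    show "c i = 0" if "i < N" for i
    proof -
      have "i < d" using that Nd by simp
      then show ?thesis
        using that not_less_Least[of i "\<lambda>i. i < d \<and> c i \<noteq> 0"] unfolding N_def
        by (auto split: if_splits)
    qed
    show "c N \<noteq> 0" if "N < d"
      using that LeastI_ex[of "\<lambda>i. i < d \<and> c i \<noteq> 0"] unfolding N_def by (auto split: if_splits)
  qed
  show thesis
  proof (rule that[of "d - N" "\<lambda>i. c (i + N)" N]; (intro allI impI)?)
    show "c (i + N) \<in> F" if "i < d - N" for i using c that by simp
    show "c (0 + N) \<noteq> 0" if "d - N > 0" using N(3) that by simp
    fix n
    have "a (n + (d - N) + N) = a (n + d)" using N(1) by simp
    also have "\<dots> = (\<Sum>i<d. c i * a (n + i))" by (rule rec)
    also have "\<dots> = (\<Sum>i\<in>{N..<d}. c i * a (n + i))"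
      by (rule sum.mono_neutral_right) (use N(2) in \<open>auto simp: not_le\<close>)
    also have "\<dots> = (\<Sum>i<d - N. c (i + N) * a (n + i + N))"
      using sum.shift_bounds_nat_ivl[of "\<lambda>i. c i * a (n + i)" 0 N "d - N"] N(1)
      by (simp add: lessThan_atLeast0 add.assoc)
    finally show "a (n + (d - N) + N) = (\<Sum>i<d - N. c (i + N) * a (n + i + N))" .
  qed
qed

lemma sml_quot_field:
  fixes A :: "'a::field_char_0 set"
  assumes A: "specialisable A"
  shows "sml_on (quot_field A)"
  unfolding sml_on_def
proof (intro allI impI)
  fix a assume aF: "\<forall>n. a n \<in> quot_field A" and "lin_rec (quot_field A) a"
  have R: "is_subring A" using A by (simp add: specialisable_def)
  obtain N d c where c: "\<forall>i<d. c i \<in> quot_field A" "d > 0 \<longrightarrow> c 0 \<noteq> 0"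
    and rec': "\<forall>n. a (n + d + N) = (\<Sum>i<d. c i * a (n + i + N))"
    by (rule lin_rec_invertible[OF subfield_quot_field[OF R] \<open>lin_rec (quot_field A) a\<close>])
  note rec = rec'[rule_format]
  have "virtually_periodic (\<lambda>n. a (n + N) = 0)"
  proof (cases "d = 0")
    case True
    then show ?thesis using rec unfolding virtually_periodic_def by (auto intro: exI[of _ 1])
  next
    case False
    define Y where "Y = c ` {..<d} \<union> (\<lambda>n. a (n + N)) ` {..<d}"
    have "Y \<subseteq> quot_field A" using c aF by (auto simp: Y_def)
    from common_denominator[OF R _ this] obtain D where D: "D \<in> A" "D \<noteq> 0" "\<forall>x\<in>Y. D * x \<in> A"
      by (auto simp: Y_def)
    \<comment> \<open>Weighting by powers of D multiplies c i by D^(d - i), a positive power, so e i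
      lies in A. The exponent \<open>Suc n\<close> instead of n supplies the factor D that the first
      d terms need as well.\<close>
    define b where "b = (\<lambda>n. D ^ Suc n * a (n + N))"
    define e where "e = (\<lambda>i. D ^ (d - i) * c i)"
    have eA: "e i \<in> A" if "i < d" for i
    proof -
      have "d - i = Suc (d - i - 1)" using that by simp
      then have "D ^ (d - i) = D ^ (d - i - 1) * D" by (metis power_Suc2)
      then have "e i = D ^ (d - i - 1) * (D * c i)" by (simp add: e_def mult.assoc)
      moreover have "D * c i \<in> A" using D(3) that by (auto simp: Y_def)
      ultimately show ?thesis using D(1) R by (auto intro!: subring_mult subring_power)
    qed
    have brec: "b (n + d) = (\<Sum>i<d. e i * b (n + i))" for n
    proof -
      have "b (n + d) = (\<Sum>i<d. D ^ Suc (n + d) * (c i * a (n + i + N)))"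
        unfolding b_def rec by (simp add: sum_distrib_left)
      also have "\<dots> = (\<Sum>i<d. e i * b (n + i))"
      proof (rule sum.cong, goal_cases)
        case (2 i)
        then have "Suc (n + d) = (d - i) + Suc (n + i)" by simp
        then have "D ^ Suc (n + d) = D ^ (d - i) * D ^ Suc (n + i)" by (metis power_add)
        then show ?case unfolding e_def b_def by (simp only: mult_ac)
      qed simp
      finally show ?thesis .
    qed
    have bA: "b n \<in> A" for n
    proof (induction n rule: less_induct)
      case (less n)
      show ?case
      proof (cases "n < d")
        case True
        have "b n = D ^ n * (D * a (n + N))" by (simp add: b_def mult_ac)
        moreover have "D * a (n + N) \<in> A" using D(3) True by (auto simp: Y_def)
        ultimately show ?thesis using D(1) R by (auto intro!: subring_mult subring_power)
      next
        case False
        then have "b n = (\<Sum>i<d. e i * b (n - d + i))" using brec[of "n - d"] by simp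
        also have "\<dots> \<in> A"
          using eA False by (intro subring_sum[OF R] subring_mult[OF R] less.IH) auto
        finally show ?thesis .
      qed
    qed
    have "virtually_periodic (\<lambda>n. b n = 0)"
      by (rule specialisable_recurrence_zeros[OF A _ eA _ bA brec])
        (use False c(2) D in \<open>auto simp: e_def\<close>)
    moreover have "b n = 0 \<longleftrightarrow> a (n + N) = 0" for n using D(2) by (simp add: b_def)
    ultimately show ?thesis by simp
  qed
  then show "virtually_periodic (\<lambda>n. a n = 0)"
    by (rule virtually_periodic_of_shift[of "\<lambda>n. a n = 0" N])
qed

lemma ex_sml_subfield:
  fixes G :: "'a::field_char_0 set"
  assumes "finite G"
  shows "\<exists>F. is_subfield F \<and> sml_on F \<and> G \<subseteq> F"
proof -
  obtain A where A: "specialisable A" "\<forall>x\<in>G. alg_over A x"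
    using ex_specialisable_alg_over[OF assms] by blast
  have R: "is_subring A" using A by (simp add: specialisable_def)
  have "\<exists>F. is_subfield F \<and> sml_on F \<and> A \<subseteq> F \<and> Y \<subseteq> F" if "finite Y" "Y \<subseteq> G" for Y
    using that
  proof (induction Y rule: finite_induct)
    case empty
    show ?case using subfield_quot_field[OF R] sml_quot_field[OF A(1)] subset_quot_field[OF R] by blast
  next
    case (insert y Y)
    then obtain F where F: "is_subfield F" "sml_on F" "A \<subseteq> F" "Y \<subseteq> F" by auto
    have y: "alg_over F y" using insert.prems A(2) alg_over_mono[OF F(3)] by blast
    note S = is_subfield_imp_subring[OF F(1)]
    show ?case
      using subfield_ring_adjoin[OF F(1) y] sml_ring_adjoin[OF F(1,2) y] subset_ring_adjoin[OF S, of y]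
        self_in_ring_adjoin[OF S, of y] F(3,4) by blast
  qed
  from this[OF assms subset_refl] show ?thesis by blast
qed

theorem skolem_mahler_lech:
  fixes a :: "nat \<Rightarrow> 'a::field_char_0"
  assumes "lin_rec UNIV a"
  shows "virtually_periodic (\<lambda>n. a n = 0)"
proof -
  obtain d c where "\<And>i. i < d \<Longrightarrow> c i \<in> UNIV" and rec: "\<And>n. a (n + d) = (\<Sum>i<d. c i * a (n + i))"
    using lin_rec_leading[OF is_subfield_UNIV assms] by blast
  obtain F where F: "is_subfield F" "sml_on F" "c ` {..<d} \<union> a ` {..<d} \<subseteq> F"
    using ex_sml_subfield[of "c ` {..<d} \<union> a ` {..<d}"] by auto
  note R = is_subfield_imp_subring[OF F(1)]
  have aF: "a n \<in> F" for n
  proof (induction n rule: less_induct)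
    case (less n)
    show ?case
    proof (cases "n < d")
      case True
      then show ?thesis using F(3) by auto
    next
      case False
      then have "a n = (\<Sum>i<d. c i * a (n - d + i))" using rec[of "n - d"] by simp
      also have "\<dots> \<in> F"
        using F(3) False by (intro subring_sum[OF R] subring_mult[OF R] less.IH) auto
      finally show ?thesis .
    qed
  qed
  \<comment> \<open>The entry - 1 at d turns the solved recurrence back into a relation, nonzero
    even for d = 0.\<close>
  define e where "e = (\<lambda>i. if i = d then - 1 else c i)"
  have "(\<Sum>i\<le>d. e i * a (n + i)) = 0" for n
  proof -
    have "(\<Sum>i\<le>d. e i * a (n + i)) = (\<Sum>i<d. e i * a (n + i)) + e d * a (n + d)"
      by (simp add: lessThan_Suc_atMost[symmetric])
    also have "(\<Sum>i<d. e i * a (n + i)) = a (n + d)"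
      unfolding rec by (rule sum.cong) (auto simp: e_def)
    finally show ?thesis by (simp add: e_def)
  qed
  then have "lin_rec F a"
    unfolding lin_rec_def using F(3) R
    by (intro exI[of _ d] exI[of _ e]) (auto simp: e_def subring_uminus subring_1)
  then show ?thesis using F(2) aF unfolding sml_on_def by blast
qed

subsection \<open>Generating functions of recurrence sequences\<close>

text \<open>Clearing the denominator leads from Laurent series to power series, where coefficients
  can be compared.\<close>

lemma gen_fun_eq_iff:
  "gen_fun_eq a p q \<longleftrightarrow> q \<noteq> 0 \<and> fps_of_poly q * Abs_fps a = fps_of_poly p"
proof (cases "q = 0")
  case False
  then have "fps_to_fls (fps_of_poly q) \<noteq> 0" by simp
  then have "fps_to_fls (Abs_fps a) = fps_to_fls (fps_of_poly p) / fps_to_fls (fps_of_poly q) \<longleftrightarrow>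
      fps_to_fls (Abs_fps a) * fps_to_fls (fps_of_poly q) = fps_to_fls (fps_of_poly p)"
    by (rule nonzero_eq_divide_eq)
  also have "\<dots> \<longleftrightarrow> fps_to_fls (fps_of_poly q * Abs_fps a) = fps_to_fls (fps_of_poly p)"
    by (simp only: fls_times_fps_to_fls mult.commute)
  also have "\<dots> \<longleftrightarrow> fps_of_poly q * Abs_fps a = fps_of_poly p"
    by (rule fps_to_fls_eq_iff)
  finally show ?thesis using False by (simp add: gen_fun_eq_def)
qed (simp add: gen_fun_eq_def)

lemma fps_of_poly_mult_nth:
  "fps_nth (fps_of_poly q * Abs_fps a) n = (\<Sum>i\<le>n. coeff q i * a (n - i))"
  by (simp add: fps_mult_nth atMost_atLeast0)

lemma rational_seq_imp_lin_rec:
  assumes "rational_seq a"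
  shows "lin_rec UNIV a"
proof -
  from assms obtain p q where pq: "q \<noteq> 0" "fps_of_poly q * Abs_fps a = fps_of_poly p"
    by (auto simp: rational_seq_def gen_fun_eq_iff)
  \<comment> \<open>D is at least the degree of q, so that the reversed coefficients of q fit, and
    beyond the degree of p, so that the coefficient of p at n + D is 0 already for n = 0.\<close>
  define D where "D = degree q + Suc (degree p)"
  have "(\<Sum>i\<le>D. coeff q (D - i) * a (n + i)) = 0" for n
  proof -
    have "(\<Sum>i\<le>D. coeff q (D - i) * a (n + i)) = (\<Sum>i\<le>D. coeff q i * a (n + D - i))"
      by (rule sum.reindex_bij_witness[of _ "\<lambda>i. D - i" "\<lambda>i. D - i"]) auto
    also have "\<dots> = (\<Sum>i\<le>n + D. coeff q i * a (n + D - i))"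
      by (rule sum.mono_neutral_left) (auto simp: D_def coeff_eq_0)
    also have "\<dots> = coeff p (n + D)"
      by (metis fps_of_poly_mult_nth fps_of_poly_nth pq(2))
    also have "\<dots> = 0" by (rule coeff_eq_0) (simp add: D_def)
    finally show ?thesis .
  qed
  moreover have "coeff q (D - (D - degree q)) \<noteq> 0" using pq(1) by (simp add: D_def)
  ultimately show ?thesis
    unfolding lin_rec_def by (intro exI[of _ D] exI[of _ "\<lambda>i. coeff q (D - i)"]) (auto intro!: exI[of _ "D - degree q"])
qed

lemma lin_rec_imp_gen_fun:
  assumes "is_subring F" "lin_rec F a"
  obtains p q where "q \<in> poly_over F" "gen_fun_eq a p q"
proof -
  from assms obtain D c where c: "\<forall>i\<le>D. c i \<in> F" "\<exists>i\<le>D. c i \<noteq> 0"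
    "\<And>n. (\<Sum>i\<le>D. c i * a (n + i)) = 0" by (auto simp: lin_rec_def)
  \<comment> \<open>The denominator is the reversed relation and so has coefficients in F; the terms
    of a enter only the numerator.\<close>
  define q where "q = (\<Sum>i\<le>D. monom (c (D - i)) i)"
  have cq: "coeff q i = (if i \<le> D then c (D - i) else 0)" for i
    by (simp add: q_def coeff_sum)
  define p where "p = (\<Sum>n<D. monom (\<Sum>i\<le>n. coeff q i * a (n - i)) n)"
  have "fps_of_poly q * Abs_fps a = fps_of_poly p"
  proof (rule fps_ext)
    fix n
    show "fps_nth (fps_of_poly q * Abs_fps a) n = fps_nth (fps_of_poly p) n"
    proof (cases "n < D")
      case True
      then show ?thesis by (simp add: fps_of_poly_mult_nth p_def coeff_sum)
    next
      case False
      have "(\<Sum>i\<le>n. coeff q i * a (n - i)) = (\<Sum>i\<le>D. coeff q i * a (n - i))"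
        by (rule sum.mono_neutral_right) (use False in \<open>auto simp: cq\<close>)
      also have "\<dots> = (\<Sum>i\<le>D. c i * a (n - D + i))"
        by (rule sum.reindex_bij_witness[of _ "\<lambda>i. D - i" "\<lambda>i. D - i"]) (use False in \<open>auto simp: cq\<close>)
      also have "\<dots> = 0" by (rule c(3))
      finally show ?thesis using False by (simp add: fps_of_poly_mult_nth p_def coeff_sum)
    qed
  qed
  moreover have "q \<noteq> 0"
  proof -
    from c(2) obtain i where "i \<le> D" "c i \<noteq> 0" by blast
    then have "coeff q (D - i) \<noteq> 0" by (simp add: cq)
    then show ?thesis by auto
  qed
  moreover have "q \<in> poly_over F"
    using c(1) subring_0[OF assms(1)] by (simp add: poly_over_def cq)
  ultimately show thesis using that by (simp add: gen_fun_eq_iff)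
qed

text \<open>A nonzero combination of least degree divides p and q, hence is a unit.\<close>

lemma coprime_poly_bezout:
  fixes p q :: "'a::field poly"
  assumes "coprime p q"
  obtains u v where "u * p + v * q = 1"
proof -
  define Q where "Q = (\<lambda>h. h \<noteq> 0 \<and> (\<exists>u v. h = u * p + v * q))"
  have "p \<noteq> 0 \<or> q \<noteq> 0" using assms by auto
  moreover have "p = 1 * p + 0 * q" "q = 0 * p + 1 * q" by simp_all
  ultimately have "\<exists>h. Q h" unfolding Q_def by metis
  then obtain h where h: "Q h" "\<And>g. Q g \<Longrightarrow> degree h \<le> degree g"
    using ex_has_least_nat[of Q _ degree] by metis
  from h(1) obtain u v where uv: "h \<noteq> 0" "h = u * p + v * q" by (auto simp: Q_def)
  have dvd: "h dvd g" if g: "g = u' * p + v' * q" for g u' v'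
  proof (rule ccontr)
    assume "\<not> h dvd g"
    then have nz: "g mod h \<noteq> 0" by (simp add: dvd_eq_mod_eq_0)
    have "g mod h = g - (g div h) * h" by (simp add: minus_div_mult_eq_mod)
    also have "\<dots> = (u' - (g div h) * u) * p + (v' - (g div h) * v) * q"
      by (subst g, subst uv(2)) (simp add: algebra_simps)
    finally have "Q (g mod h)" using nz unfolding Q_def by blast
    then show False using h(2) degree_mod_less[OF uv(1), of g] nz by fastforce
  qed
  have "h dvd p" "h dvd q" using dvd[of p 1 0] dvd[of q 0 1] by simp_all
  then have "h dvd 1" using assms by (auto simp: coprime_def)
  then obtain w where "1 = h * w" by (elim dvdE)
  then have "(w * u) * p + (w * v) * q = 1" using uv(2) by (simp add: algebra_simps)
  then show thesis by (rule that)
qed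

lemma poly_over_UNIV: "poly_over UNIV = UNIV"
  by (simp add: poly_over_def)

lemma is_subring_UNIV: "is_subring UNIV"
  by (simp add: is_subring_def)

lemma hom_on_to_ac: "hom_on UNIV to_ac"
  by (simp add: hom_on_def)

lemma map_poly_to_ac_mult: "map_poly to_ac (p * q) = map_poly to_ac p * map_poly to_ac q"
  by (rule map_poly_hom_on_mult[OF is_subring_UNIV hom_on_to_ac]) (simp_all add: poly_over_UNIV)

text \<open>The denominator in lowest terms divides any other: \<open>u * p0 + v * q0 = 1\<close>
  and \<open>p0 * q = p * q0\<close> give \<open>q = (u * p + v * q) * q0\<close>. So the poles can
  be controlled by whichever denominator is at hand.\<close>

lemma gen_fun_pole_root:
  assumes "z \<in> gen_fun_poles a" "gen_fun_eq a p q"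
  shows "poly (map_poly to_ac q) z = 0"
proof -
  from assms(1) obtain p0 q0 where 0: "gen_fun_eq a p0 q0" "coprime p0 q0" "poly (map_poly to_ac q0) z = 0"
    by (auto simp: gen_fun_poles_def)
  have "fps_of_poly (p0 * q) = fps_of_poly (p * q0)"
  proof -
    have "fps_of_poly (p0 * q) = (fps_of_poly q0 * Abs_fps a) * fps_of_poly q"
      using 0(1) by (simp add: gen_fun_eq_iff fps_of_poly_mult)
    also have "\<dots> = (fps_of_poly q * Abs_fps a) * fps_of_poly q0" by (simp only: mult_ac)
    also have "\<dots> = fps_of_poly (p * q0)"
      using assms(2) by (simp add: gen_fun_eq_iff fps_of_poly_mult)
    finally show ?thesis .
  qed
  then have eq: "p0 * q = p * q0" by (simp only: fps_of_poly_eq_iff)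
  obtain u v where uv: "u * p0 + v * q0 = 1" using coprime_poly_bezout[OF 0(2)] .
  have "q = (u * p0 + v * q0) * q" by (simp add: uv)
  also have "\<dots> = u * (p0 * q) + v * q0 * q" by (simp add: algebra_simps)
  also have "\<dots> = (u * p + v * q) * q0" by (simp add: eq algebra_simps)
  finally have "map_poly to_ac q = map_poly to_ac ((u * p + v * q) * q0)" by simp
  then have "poly (map_poly to_ac q) z = poly (map_poly to_ac (u * p + v * q) * map_poly to_ac q0) z"
    by (simp only: map_poly_to_ac_mult)
  then show ?thesis using 0(3) by simp
qed

subsection \<open>Embeddings of a finite extension into the algebraic closure\<close>

lemma hom_on_field_eq_0_iff:
  fixes f :: "'a::field \<Rightarrow> 'b::field"
  assumes F: "is_subfield F" and "hom_on F f" "x \<in> F"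
  shows "f x = 0 \<longleftrightarrow> x = 0"
proof
  note R = is_subfield_imp_subring[OF F]
  assume fx: "f x = 0"
  show "x = 0"
  proof (rule ccontr)
    assume "x \<noteq> 0"
    then have "f x * f (inverse x) = f 1"
      using hom_on_mult[OF R assms(2) assms(3) subfield_inverse[OF F assms(3)]] by simp
    then show False using fx hom_on_1[OF R assms(2)] by simp
  qed
qed (simp add: hom_on_0[OF is_subfield_imp_subring[OF F] assms(2)])

lemma is_subfield_range:
  fixes f :: "'a::field \<Rightarrow> 'b::field"
  assumes f: "hom_on UNIV f"
  shows "is_subfield (range f)"
proof (rule is_subfieldI)
  note H = hom_on_0[OF is_subring_UNIV f] hom_on_1[OF is_subring_UNIV f]
    hom_on_add[OF is_subring_UNIV f UNIV_I UNIV_I] hom_on_mult[OF is_subring_UNIV f UNIV_I UNIV_I]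
    hom_on_uminus[OF is_subring_UNIV f UNIV_I]
  show "is_subring (range f)"
    unfolding is_subring_def using H by (auto simp flip: H(3,4,5))
  fix y assume y: "y \<in> range f" "y \<noteq> 0"
  then obtain x where x: "y = f x" by blast
  then have "x \<noteq> 0" using y H by auto
  then have "y * f (inverse x) = 1" using H(4)[of x "inverse x"] H(2) x by simp
  then have "inverse y = f (inverse x)" by (rule inverse_unique)
  then show "inverse y \<in> range f" by simp
qed

lemma poly_over_range:
  fixes f :: "'a::field \<Rightarrow> 'b::field"
  assumes f: "hom_on UNIV f" and "p \<in> poly_over (range f)"
  obtains q where "p = map_poly f q"
proof -
  have inj: "inj f"
  proof (rule injI)
    fix x y assume "f x = f y"
    then have "f (x - y) = 0" using hom_on_diff[OF is_subring_UNIV f] by simp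
    then show "x = y" using hom_on_field_eq_0_iff[OF is_subfield_UNIV f] by simp
  qed
  define q where "q = map_poly (inv_into UNIV f) p"
  have f0: "f 0 = 0" by (rule hom_on_0[OF is_subring_UNIV f])
  have i0: "inv_into UNIV f 0 = 0" using inv_into_f_f[OF inj, of 0] f0 by simp
  have "coeff (map_poly f q) i = coeff p i" for i
    using assms(2) by (simp add: q_def coeff_map_poly f0 i0 poly_over_def f_inv_into_f)
  then have "p = map_poly f q" by (intro poly_eqI) simp
  then show thesis by (rule that)
qed

text \<open>Elements are adjoined one at a time; each goes to a root of the image of its minimal
  polynomial over the field reached so far.\<close>

lemma hom_on_extend_finite:
  fixes f :: "'l::field \<Rightarrow> 'b::alg_closed_field"
  assumes "finite B" "is_subfield F" "hom_on F f" "\<And>b. b \<in> B \<Longrightarrow> alg_over F b"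
  shows "\<exists>F' f'. is_subfield F' \<and> hom_on F' f' \<and> F \<subseteq> F' \<and> B \<subseteq> F' \<and> (\<forall>x\<in>F. f' x = f x)"
  using assms(1,4)
proof (induction B rule: finite_induct)
  case empty
  show ?case using assms(2,3) by blast
next
  case (insert b B)
  then obtain F' f' where F': "is_subfield F'" "hom_on F' f'" "F \<subseteq> F'" "B \<subseteq> F'" "\<forall>x\<in>F. f' x = f x"
    by auto
  note R = is_subfield_imp_subring[OF F'(1)]
  have b: "alg_over F' b" using insert.prems alg_over_mono[OF F'(3)] by blast
  obtain m where m: "m \<in> poly_over F'" "m \<noteq> 0" "poly m b = 0" "degree m > 0"
    "\<And>p. p \<in> poly_over F' \<Longrightarrow> poly p b = 0 \<Longrightarrow> \<exists>q\<in>poly_over F'. p = q * m"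
    "\<And>p. p \<in> poly_over F' \<Longrightarrow> poly p b = 0 \<Longrightarrow> degree p < degree m \<Longrightarrow> p = 0"
    using minimal_polynomial_over[OF F'(1) b] by blast
  have "coeff (map_poly f' m) (degree m) \<noteq> 0"
    using m(1,2) hom_on_field_eq_0_iff[OF F'(1,2)]
    by (simp add: coeff_map_poly hom_on_0[OF R F'(2)] poly_over_def)
  then have "degree (map_poly f' m) > 0" using m(4) le_degree[of "map_poly f' m" "degree m"] by simp
  then obtain y where y: "poly (map_poly f' m) y = 0" using alg_closed_imp_poly_has_root by blast
  have "poly (map_poly f' p) y = 0" if p: "p \<in> poly_over F'" "poly p b = 0" for p
  proof -
    obtain q where "q \<in> poly_over F'" "p = q * m" using m(5)[OF p] by blast
    then show ?thesis using m(1) y by (simp add: map_poly_hom_on_mult[OF R F'(2)])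
  qed
  from hom_on_extend[OF R F'(2), of b y, OF this] obtain g where
    g: "hom_on (ring_adjoin F' b) g" "\<And>a. a \<in> F' \<Longrightarrow> g a = f' a" by metis
  show ?case
  proof (intro exI conjI)
    show "is_subfield (ring_adjoin F' b)" by (rule subfield_ring_adjoin[OF F'(1) b])
    show "F \<subseteq> ring_adjoin F' b" "insert b B \<subseteq> ring_adjoin F' b"
      using subset_ring_adjoin[OF R, of b] self_in_ring_adjoin[OF R, of b] F'(3,4) by auto
    show "\<forall>x\<in>F. g x = f x" using g(2) F'(3,5) by auto
  qed (rule g(1))
qed

lemma prod_linear_factors_dvd:
  fixes p :: "'a::field poly"
  assumes "finite S" "\<And>b. b \<in> S \<Longrightarrow> poly p b = 0"
  shows "(\<Prod>b\<in>S. [:- b, 1:]) dvd p"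
  using assms
proof (induction S arbitrary: p rule: finite_induct)
  case (insert b S)
  have "[:- b, 1:] dvd p" using insert.prems[of b] by (simp add: poly_eq_0_iff_dvd)
  then obtain q where q: "p = [:- b, 1:] * q" by (elim dvdE)
  have "(\<Prod>b\<in>S. [:- b, 1:]) dvd q"
  proof (rule insert.IH)
    fix c assume "c \<in> S"
    then show "poly q c = 0" using insert.prems[of c] insert.hyps by (auto simp: q)
  qed
  then show ?case
    unfolding q prod.insert[OF insert.hyps] by (rule mult_dvd_mono[OF dvd_refl])
qed simp

lemma monic_simple_roots_eq_prod:
  fixes p :: "'a::alg_closed_field poly"
  assumes "lead_coeff p = 1" and simple: "\<And>z. poly p z = 0 \<Longrightarrow> poly (pderiv p) z \<noteq> 0"
  shows "p = (\<Prod>b\<in>{z. poly p z = 0}. [:- b, 1:])"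
proof -
  define S where "S = {z. poly p z = 0}"
  define Q where "Q = (\<Prod>b\<in>S. [:- b, 1:])"
  have p0: "p \<noteq> 0" using assms(1) by auto
  then have S: "finite S" unfolding S_def by (rule poly_roots_finite)
  have "Q dvd p" unfolding Q_def by (rule prod_linear_factors_dvd[OF S]) (simp add: S_def)
  then obtain T where T: "p = Q * T" by (elim dvdE)
  \<comment> \<open>A root of the cofactor T is a root of p, hence already a root of Q, and so a
    double root of p.\<close>
  have "degree T = 0"
  proof (rule ccontr)
    assume "degree T \<noteq> 0"
    then obtain z where z: "poly T z = 0" using alg_closed_imp_poly_has_root by blast
    then have "z \<in> S" by (simp add: S_def T)
    then have "poly Q z = 0" unfolding Q_def using S by (auto simp: poly_prod)
    then have "poly (pderiv p) z = 0" using z by (simp add: T pderiv_mult)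
    then show False using simple[of z] \<open>z \<in> S\<close> by (simp add: S_def)
  qed
  then obtain t where t: "T = [:t:]" by (metis degree_eq_zeroE)
  have "lead_coeff Q = 1" unfolding Q_def by (simp add: lead_coeff_prod)
  moreover have "t \<noteq> 0" using p0 T t by auto
  ultimately have "t = 1" using assms(1) by (simp add: T lead_coeff_mult t)
  then have "p = Q" by (simp add: T t)
  then show ?thesis by (simp add: Q_def S_def)
qed

section \<open>Minimal polynomials and degrees over the base field\<close>

context
  fixes \<iota> :: "'k::field_char_0 \<Rightarrow> 'l::field_char_0"
  assumes fin: "finite_extension \<iota>"
begin

lemma hom_on_iota: "hom_on UNIV \<iota>"
  using fin by (simp add: finite_extension_def field_embedding_def hom_on_def)

lemmas iota_0 = hom_on_0[OF is_subring_UNIV hom_on_iota]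
lemmas iota_1 = hom_on_1[OF is_subring_UNIV hom_on_iota]
lemmas iota_add = hom_on_add[OF is_subring_UNIV hom_on_iota UNIV_I UNIV_I]
lemmas iota_mult = hom_on_mult[OF is_subring_UNIV hom_on_iota UNIV_I UNIV_I]
lemmas iota_eq_0_iff = hom_on_field_eq_0_iff[OF is_subfield_UNIV hom_on_iota UNIV_I]
lemmas map_iota_mult =
  map_poly_hom_on_mult[OF is_subring_UNIV hom_on_iota, unfolded poly_over_UNIV, OF UNIV_I UNIV_I]
lemmas map_iota_add =
  map_poly_hom_on_add[OF is_subring_UNIV hom_on_iota, unfolded poly_over_UNIV, OF UNIV_I UNIV_I]
lemmas map_iota_diff =
  map_poly_hom_on_diff[OF is_subring_UNIV hom_on_iota, unfolded poly_over_UNIV, OF UNIV_I UNIV_I]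
lemmas subfield_range_iota = is_subfield_range[OF hom_on_iota]

lemma degree_map_iota: "degree (map_poly \<iota> q) = degree q"
  by (rule degree_map_poly) (simp add: iota_eq_0_iff)

lemma vector_space_iota: "vector_space (ext_scale \<iota>)"
  by unfold_locales (simp_all add: ext_scale_def iota_1 iota_add iota_mult algebra_simps)

lemma finite_spanning_set:
  obtains B where "finite B" "\<And>y. \<exists>u. y = (\<Sum>b\<in>B. \<iota> (u b) * b)"
proof -
  interpret vector_space "ext_scale \<iota>" by (rule vector_space_iota)
  obtain B where B: "finite B" "span B = UNIV" using fin by (auto simp: finite_extension_def)
  have "\<exists>u. y = (\<Sum>b\<in>B. \<iota> (u b) * b)" for y
  proof -
    have "y \<in> range (\<lambda>u. \<Sum>v\<in>B. ext_scale \<iota> (u v) v)" using B span_finite[OF B(1)] by blast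
    then show ?thesis by (auto simp: ext_scale_def)
  qed
  then show thesis using that B by blast
qed

lemma alg_over_range_iota: "alg_over (range \<iota>) y"
proof -
  obtain B where B: "finite B" "\<And>y. \<exists>u. y = (\<Sum>b\<in>B. \<iota> (u b) * b)"
    using finite_spanning_set by blast
  show ?thesis
  proof (rule powers_in_span_imp_alg_over[OF subfield_range_iota B(1)])
    fix k
    obtain u where "y ^ k = (\<Sum>b\<in>B. \<iota> (u b) * b)" using B(2) by blast
    then show "\<exists>c. (\<forall>b\<in>B. c b \<in> range \<iota>) \<and> y ^ k = (\<Sum>b\<in>B. c b * b)"
      by (intro exI[of _ "\<lambda>b. \<iota> (u b)"]) auto
  qed
qed

lemma poly_map_iota_smult: "poly (map_poly \<iota> (smult c q)) y = \<iota> c * poly (map_poly \<iota> q) y"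
proof -
  have "map_poly \<iota> (smult c q) = smult (\<iota> c) (map_poly \<iota> q)"
    by (rule poly_eqI) (simp add: coeff_map_poly iota_0 iota_mult)
  then show ?thesis by simp
qed

text \<open>Gives the \<open>THE\<close> in \<open>min_poly\<close> its meaning. Two monic
  candidates of equal degree cancel in top degree, so a nonzero difference would contradict
  minimality.\<close>

lemma min_poly_unique_ex:
  "\<exists>!p. lead_coeff p = 1 \<and> poly (map_poly \<iota> p) y = 0 \<and>
     (\<forall>q. q \<noteq> 0 \<and> poly (map_poly \<iota> q) y = 0 \<longrightarrow> degree p \<le> degree q)"
proof -
  define Q where "Q = (\<lambda>q. q \<noteq> 0 \<and> poly (map_poly \<iota> q) y = 0)"
  from alg_over_range_iota[of y] obtain q where q: "q \<in> poly_over (range \<iota>)" "q \<noteq> 0" "poly q y = 0"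
    unfolding alg_over_def by blast
  obtain q' where "q = map_poly \<iota> q'" using poly_over_range[OF hom_on_iota q(1)] .
  with q have "Q q'" by (auto simp: Q_def)
  then obtain m where m: "Q m" "\<And>p. Q p \<Longrightarrow> degree m \<le> degree p"
    using ex_has_least_nat[of Q _ degree] by metis
  have m0: "m \<noteq> 0" using m(1) by (simp add: Q_def)
  define p where "p = smult (inverse (lead_coeff m)) m"
  show ?thesis
  proof (rule ex1I[of _ p])
    show "lead_coeff p = 1 \<and> poly (map_poly \<iota> p) y = 0 \<and>
      (\<forall>q. q \<noteq> 0 \<and> poly (map_poly \<iota> q) y = 0 \<longrightarrow> degree p \<le> degree q)"
      using m m0 unfolding p_def Q_def by (simp add: poly_map_iota_smult)
  next
    fix r
    assume r: "lead_coeff r = 1 \<and> poly (map_poly \<iota> r) y = 0 \<and>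
      (\<forall>q. q \<noteq> 0 \<and> poly (map_poly \<iota> q) y = 0 \<longrightarrow> degree r \<le> degree q)"
    have p: "lead_coeff p = 1" "poly (map_poly \<iota> p) y = 0" "degree p = degree m"
      using m m0 unfolding p_def Q_def by (simp_all add: poly_map_iota_smult)
    have dr: "degree r = degree p"
    proof (rule antisym)
      show "degree r \<le> degree p" using r p by (metis coeff_0 zero_neq_one)
      show "degree p \<le> degree r" unfolding p(3) using r by (intro m(2)) (auto simp: Q_def)
    qed
    show "r = p"
    proof (rule ccontr)
      assume "r \<noteq> p"
      then have nz: "r - p \<noteq> 0" by simp
      have "poly (map_poly \<iota> (r - p)) y = 0" using r p by (simp add: map_iota_diff)
      then have le: "degree p \<le> degree (r - p)" using m(2)[of "r - p"] nz p(3) by (simp add: Q_def)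
      have "degree (r - p) \<le> degree p" using degree_diff_le_max[of r p] dr by simp
      with le have "coeff (r - p) (degree p) \<noteq> 0" using nz by (metis antisym leading_coeff_0_iff)
      then show False using r p dr by simp
    qed
  qed
qed

lemma min_poly_monic: "lead_coeff (min_poly \<iota> y) = 1"
  and min_poly_root: "poly (map_poly \<iota> (min_poly \<iota> y)) y = 0"
  and min_poly_minimal:
    "q \<noteq> 0 \<Longrightarrow> poly (map_poly \<iota> q) y = 0 \<Longrightarrow> degree (min_poly \<iota> y) \<le> degree q"
  using theI'[OF min_poly_unique_ex[of y]] unfolding min_poly_def by blast+

lemma min_poly_nz: "min_poly \<iota> y \<noteq> 0"
  using min_poly_monic[of y] by auto

lemma poly_mod_min_poly:
  "poly (map_poly \<iota> (q mod min_poly \<iota> y)) y = poly (map_poly \<iota> q) y"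
proof -
  have "q = q div min_poly \<iota> y * min_poly \<iota> y + q mod min_poly \<iota> y"
    by (rule div_mult_mod_eq[symmetric])
  then have "poly (map_poly \<iota> q) y =
      poly (map_poly \<iota> (q div min_poly \<iota> y * min_poly \<iota> y + q mod min_poly \<iota> y)) y" by simp
  then show ?thesis by (simp only: map_iota_add map_iota_mult poly_add poly_mult min_poly_root) simp
qed

lemma degree_min_poly_pos: "degree (min_poly \<iota> y) > 0"
proof (rule ccontr)
  assume "\<not> degree (min_poly \<iota> y) > 0"
  then obtain c where c: "min_poly \<iota> y = [:c:]" by (metis degree_eq_zeroE neq0_conv)
  then have "c = 1" using min_poly_monic[of y] by simp
  then show False using min_poly_root[of y] c by (simp add: map_poly_pCons iota_0 iota_1)
qed

lemma degree_mod_min_poly: "degree (q mod min_poly \<iota> y) < degree (min_poly \<iota> y)"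
  using degree_mod_less[OF min_poly_nz, of q y] degree_min_poly_pos[of y] by auto

lemma min_poly_dvd:
  assumes "poly (map_poly \<iota> q) y = 0"
  shows "min_poly \<iota> y dvd q"
proof (rule ccontr)
  assume "\<not> min_poly \<iota> y dvd q"
  then have "q mod min_poly \<iota> y \<noteq> 0" by (simp add: dvd_eq_mod_eq_0)
  then show False
    using min_poly_minimal[of "q mod min_poly \<iota> y" y] assms degree_mod_min_poly[of q y]
    by (simp add: poly_mod_min_poly)
qed

text \<open>As y is algebraic, the polynomials in y already form a field.\<close>

lemma adjoin_eq_ring_adjoin: "adjoin \<iota> y = ring_adjoin (range \<iota>) y"
proof
  note R = is_subfield_imp_subring[OF subfield_range_iota]
  show "adjoin \<iota> y \<subseteq> ring_adjoin (range \<iota>) y"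
    unfolding adjoin_def
    using subfield_ring_adjoin[OF subfield_range_iota alg_over_range_iota[of y]]
      subset_ring_adjoin[OF R] self_in_ring_adjoin[OF R] by blast
  show "ring_adjoin (range \<iota>) y \<subseteq> adjoin \<iota> y"
    unfolding adjoin_def using ring_adjoin_least[OF is_subfield_imp_subring] by blast
qed

text \<open>The powers of y with exponent below the degree of the minimal polynomial form a
  basis.\<close>

lemma ext_degree_eq_degree_min_poly: "ext_degree \<iota> y = degree (min_poly \<iota> y)"
proof -
  interpret vector_space "ext_scale \<iota>" by (rule vector_space_iota)
  define d where "d = degree (min_poly \<iota> y)"
  have ind: "u l = 0" if "(\<Sum>l<d. \<iota> (u l) * y ^ l) = 0" "l < d" for u l
  proof -
    define q where "q = (\<Sum>l<d. monom (u l) l)"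
    have cq: "coeff q i = (if i < d then u i else 0)" for i by (simp add: q_def coeff_sum)
    have dq: "degree q < d"
      using degree_min_poly_pos[of y] cq unfolding d_def by (metis degree_0 leading_coeff_0_iff)
    have "poly (map_poly \<iota> q) y = (\<Sum>l\<le>degree (map_poly \<iota> q). \<iota> (coeff q l) * y ^ l)"
      by (simp add: poly_altdef coeff_map_poly iota_0)
    also have "\<dots> = (\<Sum>l<d. \<iota> (coeff q l) * y ^ l)"
      using dq degree_map_iota[of q]
      by (intro sum.mono_neutral_left) (auto simp: coeff_eq_0 iota_0)
    also have "\<dots> = (\<Sum>l<d. \<iota> (u l) * y ^ l)" by (rule sum.cong) (auto simp: cq)
    finally have "poly (map_poly \<iota> q) y = 0" using that by simp
    then have "q = 0" using min_poly_minimal[of q y] dq unfolding d_def by fastforce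
    then show ?thesis using cq[of l] that by simp
  qed
  have inj: "inj_on (\<lambda>l. y ^ l) {..<d}"
  proof (rule inj_onI, rule ccontr)
    fix i j assume ij: "i \<in> {..<d}" "j \<in> {..<d}" "y ^ i = y ^ j" "i \<noteq> j"
    define c where "c = (\<lambda>l. if l = i then 1 else if l = j then - 1 else 0 :: 'k)"
    have m1: "\<iota> (- 1) = - 1" using hom_on_uminus[OF is_subring_UNIV hom_on_iota, of 1] iota_1 by simp
    have "(\<Sum>l<d. \<iota> (c l) * y ^ l) = (\<Sum>l\<in>{i, j}. \<iota> (c l) * y ^ l)"
      by (rule sum.mono_neutral_right) (use ij in \<open>auto simp: c_def iota_0\<close>)
    also have "\<dots> = 0" using ij by (simp add: c_def iota_1 m1)
    finally have "c i = 0" using ind[of c i] ij by simp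
    then show False by (simp add: c_def)
  qed
  define B where "B = (\<lambda>l. y ^ l) ` {..<d}"
  have "dim (adjoin \<iota> y) = d"
  proof (rule dim_unique)
    note R = is_subfield_imp_subring[OF subfield_range_iota]
    show "B \<subseteq> adjoin \<iota> y"
      unfolding B_def adjoin_eq_ring_adjoin
      by (auto intro!: subring_power[OF subring_ring_adjoin[OF R]] self_in_ring_adjoin[OF R])
    show "adjoin \<iota> y \<subseteq> span B"
    proof
      fix z assume "z \<in> adjoin \<iota> y"
      then obtain p where p: "p \<in> poly_over (range \<iota>)" "z = poly p y"
        by (auto simp: adjoin_eq_ring_adjoin ring_adjoin_def)
      obtain q where q: "p = map_poly \<iota> q" using poly_over_range[OF hom_on_iota p(1)] .
      define r where "r = q mod min_poly \<iota> y"
      have "z = poly (map_poly \<iota> r) y" by (simp add: p q r_def poly_mod_min_poly)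
      also have "\<dots> = (\<Sum>l\<le>degree (map_poly \<iota> r). ext_scale \<iota> (coeff r l) (y ^ l))"
        by (simp add: poly_altdef coeff_map_poly iota_0 ext_scale_def)
      also have "\<dots> \<in> span B"
      proof (intro span_sum span_scale span_base)
        fix l assume "l \<in> {..degree (map_poly \<iota> r)}"
        then have "l \<le> degree r" using degree_map_iota[of r] by simp
        also have "degree r < d" unfolding r_def d_def by (rule degree_mod_min_poly)
        finally show "y ^ l \<in> B" by (simp add: B_def)
      qed
      finally show "z \<in> span B" .
    qed
    show "independent B"
    proof (rule independent_if_scalars_zero)
      show "finite B" by (simp add: B_def)
      fix u b assume u: "(\<Sum>b\<in>B. ext_scale \<iota> (u b) b) = 0" and b: "b \<in> B"
      have "(\<Sum>l<d. \<iota> (u (y ^ l)) * y ^ l) = 0"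
        using u unfolding B_def by (simp add: sum.reindex[OF inj] ext_scale_def)
      then show "u b = 0" using ind[of "\<lambda>l. u (y ^ l)"] b by (auto simp: B_def)
    qed
    show "card B = d" unfolding B_def by (simp add: card_image[OF inj])
  qed
  then show ?thesis by (simp add: ext_degree_def d_def)
qed

section \<open>Embeddings over the base field and conjugates\<close>

definition ac_embeddings :: "('l \<Rightarrow> 'k alg_closure) set" where
  "ac_embeddings = {s. hom_on UNIV s \<and> (\<forall>c. s (\<iota> c) = to_ac c)}"

lemma embedding_hom: "s \<in> ac_embeddings \<Longrightarrow> hom_on UNIV s"
  and embedding_iota: "s \<in> ac_embeddings \<Longrightarrow> s (\<iota> c) = to_ac c"
  by (auto simp: ac_embeddings_def)

lemma embedding_eq_0_iff: "s \<in> ac_embeddings \<Longrightarrow> s x = 0 \<longleftrightarrow> x = 0"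
  by (rule hom_on_field_eq_0_iff[OF is_subfield_UNIV embedding_hom UNIV_I])

lemma embedding_poly:
  assumes s: "s \<in> ac_embeddings"
  shows "s (poly (map_poly \<iota> q) y) = poly (map_poly to_ac q) (s y)"
proof -
  have "map_poly s (map_poly \<iota> q) = map_poly to_ac q"
    by (rule poly_eqI)
      (simp add: coeff_map_poly iota_0 embedding_iota[OF s] hom_on_0[OF is_subring_UNIV embedding_hom[OF s]])
  then show ?thesis
    using hom_on_poly[OF is_subring_UNIV embedding_hom[OF s], of "map_poly \<iota> q" y]
    by (simp add: poly_over_UNIV)
qed

lemma embedding_root: "s \<in> ac_embeddings \<Longrightarrow> poly (map_poly to_ac (min_poly \<iota> y)) (s y) = 0"
  using embedding_poly[of s "min_poly \<iota> y" y] min_poly_root[of y] embedding_eq_0_iff[of s 0] by simp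

text \<open>Converse of \<open>embedding_root\<close>: sending y to z defines a map on K[y], which
  extends over a finite spanning set of L.\<close>

lemma ex_embedding:
  assumes "poly (map_poly to_ac (min_poly \<iota> y)) z = 0"
  obtains s where "s \<in> ac_embeddings" "s y = z"
proof -
  define f where "f = (\<lambda>x. to_ac (inv_into UNIV \<iota> x))"
  note R = is_subfield_imp_subring[OF subfield_range_iota]
  have "inj \<iota>"
  proof (rule injI)
    fix x y assume "\<iota> x = \<iota> y"
    then have "\<iota> (x - y) = 0" using hom_on_diff[OF is_subring_UNIV hom_on_iota] by simp
    then show "x = y" by (simp add: iota_eq_0_iff)
  qed
  then have f: "f (\<iota> x) = to_ac x" for x by (simp add: f_def)
  have hf: "hom_on (range \<iota>) f"
    unfolding hom_on_def
    by (auto simp: f simp flip: iota_add iota_mult) (metis f iota_1 to_ac_1)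
  have map_f: "map_poly f (map_poly \<iota> q) = map_poly to_ac q" for q
    by (rule poly_eqI) (simp add: coeff_map_poly iota_0 f hom_on_0[OF R hf])
  have "poly (map_poly f p) z = 0" if p: "p \<in> poly_over (range \<iota>)" "poly p y = 0" for p
  proof -
    obtain q where q: "p = map_poly \<iota> q" using poly_over_range[OF hom_on_iota p(1)] .
    obtain w where "q = min_poly \<iota> y * w" using min_poly_dvd[of q y] p q by (auto elim: dvdE)
    then show ?thesis
      using assms map_poly_hom_on_mult[OF is_subring_UNIV hom_on_to_ac, of "min_poly \<iota> y" w]
      by (simp add: q map_f poly_over_UNIV)
  qed
  from hom_on_extend[OF R hf, of y z, OF this] obtain g where
    g: "hom_on (ring_adjoin (range \<iota>) y) g" "\<And>a. a \<in> range \<iota> \<Longrightarrow> g a = f a" "g y = z" by metis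
  obtain B where B: "finite B" "\<And>y. \<exists>u. y = (\<Sum>b\<in>B. \<iota> (u b) * b)"
    using finite_spanning_set by blast
  have "alg_over (ring_adjoin (range \<iota>) y) b" for b
    using alg_over_mono[OF subset_ring_adjoin[OF R]] alg_over_range_iota by blast
  from hom_on_extend_finite[OF B(1) subfield_ring_adjoin[OF subfield_range_iota alg_over_range_iota[of y]] g(1) this]
  obtain F s where s: "is_subfield F" "hom_on F s" "ring_adjoin (range \<iota>) y \<subseteq> F" "B \<subseteq> F"
    "\<forall>x\<in>ring_adjoin (range \<iota>) y. s x = g x" by blast
  have rF: "range \<iota> \<subseteq> F" using s(3) subset_ring_adjoin[OF R] by blast
  have "x \<in> F" for x
  proof -
    obtain u where "x = (\<Sum>b\<in>B. \<iota> (u b) * b)" using B(2) by blast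
    also have "\<dots> \<in> F"
      using s(4) rF by (intro subring_sum subring_mult is_subfield_imp_subring[OF s(1)]) auto
    finally show ?thesis .
  qed
  \<comment> \<open>The domain F contains K and a spanning set of L over K.\<close>
  then have "F = UNIV" by blast
  show thesis
  proof (rule that[of s])
    have "s (\<iota> c) = to_ac c" for c
      using s(5) subset_ring_adjoin[OF R, of y] g(2)[of "\<iota> c"] f by (metis rangeI subsetD)
    then show "s \<in> ac_embeddings" using s(2) \<open>F = UNIV\<close> by (simp add: ac_embeddings_def)
    show "s y = z" using s(5) self_in_ring_adjoin[OF R, of y] g(3) by simp
  qed
qed

text \<open>An embedding is determined by its values on a finite spanning set, and each of these is
  a root of a fixed polynomial.\<close>

lemma finite_embeddings: "finite ac_embeddings"
proof -
  obtain B where B: "finite B" "\<And>y. \<exists>u. y = (\<Sum>b\<in>B. \<iota> (u b) * b)"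
    using finite_spanning_set by blast
  define Z where "Z = (\<lambda>b. {z. poly (map_poly to_ac (min_poly \<iota> b)) z = 0})"
  have "map_poly to_ac (min_poly \<iota> b) \<noteq> 0" for b
    using min_poly_nz[of b] by (simp add: map_poly_eq_0_iff)
  then have "finite (PiE B Z)"
    using B(1) by (intro finite_PiE) (auto simp: Z_def intro!: poly_roots_finite)
  moreover have "(\<lambda>s. restrict s B) ` ac_embeddings \<subseteq> PiE B Z"
    by (intro image_subsetI restrict_PiE_iff[THEN iffD2]) (auto simp: Z_def embedding_root)
  moreover have "inj_on (\<lambda>s. restrict s B) ac_embeddings"
  proof (rule inj_onI, rule ext)
    fix s t x assume st: "s \<in> ac_embeddings" "t \<in> ac_embeddings" "restrict s B = restrict t B"
    obtain u where u: "x = (\<Sum>b\<in>B. \<iota> (u b) * b)" using B(2) by blast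
    have ev: "s x = (\<Sum>b\<in>B. to_ac (u b) * s b)" if "s \<in> ac_embeddings" for s
      unfolding u
      by (simp add: hom_on_sum[OF is_subring_UNIV embedding_hom[OF that]]
          hom_on_mult[OF is_subring_UNIV embedding_hom[OF that]] embedding_iota[OF that])
    have "s b = t b" if "b \<in> B" for b using fun_cong[OF st(3), of b] that by simp
    then have "(\<Sum>b\<in>B. to_ac (u b) * s b) = (\<Sum>b\<in>B. to_ac (u b) * t b)" by simp
    then show "s x = t x" by (simp only: ev st)
  qed
  ultimately show ?thesis using finite_subset finite_imageD by blast
qed

text \<open>The product runs over a set of values, so coinciding conjugates count once. This is
  right because minimal polynomials have simple roots in characteristic zero.\<close>

lemma min_poly_eq_prod_conjugates:
  "map_poly to_ac (min_poly \<iota> y) = (\<Prod>z\<in>(\<lambda>s. s y) ` ac_embeddings. [:- z, 1:])"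
proof -
  define p where "p = map_poly to_ac (min_poly \<iota> y)"
  have "degree p = degree (min_poly \<iota> y)" unfolding p_def by (rule degree_map_poly) simp
  then have lc: "lead_coeff p = 1" using min_poly_monic[of y] by (simp add: p_def coeff_map_poly)
  have roots: "{z. poly p z = 0} = (\<lambda>s. s y) ` ac_embeddings"
    unfolding p_def using embedding_root[of _ y] ex_embedding[of y] by (auto simp: image_iff) metis
  have "poly (pderiv p) z \<noteq> 0" if z: "poly p z = 0" for z
  proof
    assume d: "poly (pderiv p) z = 0"
    \<comment> \<open>A double root s y pulls back along s to a zero y of the derivative, which is
      nonzero and of smaller degree than the minimal polynomial.\<close>
    obtain s where s: "s \<in> ac_embeddings" "s y = z" using ex_embedding[of y z] z by (auto simp: p_def)
    have "pderiv p = map_poly to_ac (pderiv (min_poly \<iota> y))"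
      unfolding p_def by (rule poly_eqI) (simp add: coeff_pderiv coeff_map_poly)
    then have "s (poly (map_poly \<iota> (pderiv (min_poly \<iota> y))) y) = 0"
      using d s embedding_poly[OF s(1)] by simp
    then have "poly (map_poly \<iota> (pderiv (min_poly \<iota> y))) y = 0"
      using embedding_eq_0_iff[OF s(1)] by simp
    moreover have "pderiv (min_poly \<iota> y) \<noteq> 0"
      using degree_min_poly_pos[of y] by (simp add: pderiv_eq_0_iff)
    ultimately have "degree (min_poly \<iota> y) \<le> degree (pderiv (min_poly \<iota> y))"
      by (intro min_poly_minimal)
    then show False using degree_min_poly_pos[of y] by (simp add: degree_pderiv)
  qed
  from monic_simple_roots_eq_prod[OF lc this] have "p = (\<Prod>z\<in>(\<lambda>s. s y) ` ac_embeddings. [:- z, 1:])"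
    unfolding roots .
  then show ?thesis by (simp only: p_def)
qed

lemma degree_min_poly_eq_card: "degree (min_poly \<iota> y) = card ((\<lambda>s. s y) ` ac_embeddings)"
proof -
  have "degree (min_poly \<iota> y) = degree (map_poly to_ac (min_poly \<iota> y))"
    by (rule degree_map_poly[symmetric]) simp
  also have "\<dots> = (\<Sum>z\<in>(\<lambda>s. s y) ` ac_embeddings. degree [:- z, 1:])"
    unfolding min_poly_eq_prod_conjugates by (rule degree_prod_eq_sum_degree) auto
  finally show ?thesis by simp
qed

end

subsection \<open>Conjugates of a recurrence sequence\<close>

lemma lin_rec_hom:
  fixes f :: "'a::field \<Rightarrow> 'b::field"
  assumes "lin_rec UNIV a" and f: "hom_on UNIV f"
  shows "lin_rec (range f) (\<lambda>n. f (a n))"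
proof -
  from assms obtain D c where c: "\<exists>i\<le>D. c i \<noteq> 0" "\<And>n. (\<Sum>i\<le>D. c i * a (n + i)) = 0"
    by (auto simp: lin_rec_def)
  note H = hom_on_sum[OF is_subring_UNIV f UNIV_I] hom_on_mult[OF is_subring_UNIV f UNIV_I UNIV_I]
    hom_on_0[OF is_subring_UNIV f] hom_on_field_eq_0_iff[OF is_subfield_UNIV f UNIV_I]
  have "(\<Sum>i\<le>D. f (c i) * f (a (n + i))) = 0" for n
    using arg_cong[OF c(2)[of n], of f] by (simp add: H)
  moreover have "\<exists>i\<le>D. f (c i) \<noteq> 0" using c(1) by (simp add: H(4))
  ultimately show ?thesis
    unfolding lin_rec_def by (intro exI[of _ D] exI[of _ "\<lambda>i. f (c i)"]) auto
qed

lemma lin_rec_mono: "F \<subseteq> G \<Longrightarrow> lin_rec F a \<Longrightarrow> lin_rec G a"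
  unfolding lin_rec_def by (meson subsetD)

text \<open>Apply to the coefficients of the recurrence a linear functional that does not kill all of them.\<close>
lemma lin_rec_of_to_ac:
  fixes b :: "nat \<Rightarrow> 'a::field"
  assumes "lin_rec UNIV (\<lambda>n. to_ac (b n))"
  shows "lin_rec UNIV b"
proof -
  interpret V: vector_space_pair "(*) :: 'a \<Rightarrow> 'a \<Rightarrow> 'a" "ext_scale to_ac :: 'a \<Rightarrow> 'a alg_closure \<Rightarrow> 'a alg_closure"
    by unfold_locales (simp_all add: ext_scale_def algebra_simps)
  have "Vector_Spaces.linear ((*) :: 'a \<Rightarrow> 'a \<Rightarrow> 'a) (ext_scale to_ac) to_ac"
    by unfold_locales (simp_all add: ext_scale_def)
  from V.linear_injective_left_inverse[OF this inj_to_ac]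
  \<comment> \<open>g is a K-linear retraction of the closure onto K.\<close>
  obtain g where g: "Vector_Spaces.linear (ext_scale to_ac) ((*) :: 'a \<Rightarrow> 'a \<Rightarrow> 'a) g" "g \<circ> to_ac = id" by blast
  interpret g: Vector_Spaces.linear "ext_scale to_ac" "(*) :: 'a \<Rightarrow> 'a \<Rightarrow> 'a" g by (rule g(1))
  from assms obtain D c i0 where c: "i0 \<le> D" "c i0 \<noteq> 0" "\<And>n. (\<Sum>i\<le>D. c i * to_ac (b (n + i))) = 0"
    by (auto simp: lin_rec_def)
  \<comment> \<open>Scaling makes the coefficient at i0 equal to 1, which g fixes, so the new
    relation is nonzero.\<close>
  define e where "e = (\<lambda>i. g (c i / c i0))"
  have "(\<Sum>i\<le>D. e i * b (n + i)) = 0" for n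
  proof -
    have "(\<Sum>i\<le>D. ext_scale to_ac (b (n + i)) (c i / c i0)) = (\<Sum>i\<le>D. c i * to_ac (b (n + i))) / c i0"
      by (simp add: ext_scale_def sum_divide_distrib mult.commute)
    then have "g (\<Sum>i\<le>D. ext_scale to_ac (b (n + i)) (c i / c i0)) = 0"
      by (simp add: c(3) g.zero)
    then show ?thesis by (simp add: g.sum g.scale e_def mult.commute)
  qed
  moreover have "e i0 = 1" using c(2) fun_cong[OF g(2), of 1] by (simp add: e_def)
  ultimately show ?thesis
    unfolding lin_rec_def using c(1) by (intro exI[of _ D] exI[of _ e]) auto
qed

text \<open>The coefficients are, up to sign, elementary symmetric functions of the s i n. The index
  set S does not vary with n, so a product over distinct conjugates must first be brought into this
  form.\<close>

lemma lin_rec_coeff_prod: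
  fixes s :: "'i \<Rightarrow> nat \<Rightarrow> 'a::field"
  assumes "finite S" "\<And>i. i \<in> S \<Longrightarrow> lin_rec UNIV (s i)"
  shows "lin_rec UNIV (\<lambda>n. coeff (\<Prod>i\<in>S. [:- s i n, 1:]) k)"
  using assms
proof (induction S arbitrary: k rule: finite_induct)
  case empty
  show ?case by (simp add: lin_rec_const[OF is_subring_UNIV])
next
  case (insert i S)
  define Q where "Q = (\<lambda>n. \<Prod>i\<in>S. [:- s i n, 1:])"
  have Q: "lin_rec UNIV (\<lambda>n. coeff (Q n) k)" for k
    unfolding Q_def using insert by auto
  have "(\<lambda>n. coeff (\<Prod>i\<in>insert i S. [:- s i n, 1:]) k) =
      (\<lambda>n. - (s i n * coeff (Q n) k) + (case k of 0 \<Rightarrow> 0 | Suc l \<Rightarrow> coeff (Q n) l))"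
    using insert.hyps by (cases k) (simp_all add: Q_def)
  moreover have "lin_rec UNIV (\<lambda>n. case k of 0 \<Rightarrow> 0 | Suc l \<Rightarrow> coeff (Q n) l)"
    by (cases k) (simp_all add: Q lin_rec_0[OF is_subring_UNIV])
  moreover have "lin_rec UNIV (s i)" using insert.prems by simp
  ultimately show ?case
    by (simp only: lin_rec_add[OF is_subfield_UNIV] lin_rec_uminus lin_rec_mult[OF is_subfield_UNIV] Q)
qed

lemma ex_inj_on_subset_same_image: "\<exists>R\<subseteq>S. inj_on f R \<and> f ` R = f ` S"
proof -
  have "\<exists>R. R \<subseteq> S \<and> inj_on f R \<and> f ` S = f ` R"
    using subset_image_inj[THEN iffD1, OF subset_refl] .
  then show ?thesis by (elim exE conjE) (intro exI conjI, assumption+, simp)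
qed

text \<open>Being a system of representatives depends only on the partition into fibres. Here f and
  g will evaluate embeddings at two indices with the same coincidences.\<close>

lemma same_fibres_transfer:
  assumes "R \<subseteq> S" "inj_on f R" "f ` R = f ` S"
    and fib: "\<And>x y. x \<in> S \<Longrightarrow> y \<in> S \<Longrightarrow> f x = f y \<longleftrightarrow> g x = g y"
  shows "inj_on g R" "g ` R = g ` S"
proof -
  show "inj_on g R" using assms unfolding inj_on_def by (metis subsetD)
  show "g ` R = g ` S"
  proof
    show "g ` S \<subseteq> g ` R"
    proof
      fix z assume "z \<in> g ` S"
      then obtain x where x: "x \<in> S" "z = g x" by blast
      then obtain y where "y \<in> R" "f x = f y" using assms(3) by (metis imageE imageI)
      then show "z \<in> g ` R" using x fib[of x y] assms(1) by auto
    qed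
  qed (use assms(1) in blast)
qed

lemma hom_on_const_to_fract: "hom_on UNIV (\<lambda>c::'k::field. to_fract [:c:])"
  unfolding hom_on_def
proof (intro conjI ballI)
  show "to_fract [:1 :: 'k:] = 1" by (metis one_pCons to_fract_1)
  fix x y :: 'k
  have "[:x + y:] = [:x:] + [:y:]" "[:x * y:] = [:x:] * [:y:]" by simp_all
  then show "to_fract [:x + y:] = to_fract [:x:] + to_fract [:y:]"
    "to_fract [:x * y:] = to_fract [:x:] * to_fract [:y:]"
    by (simp_all only: to_fract_add to_fract_mult)
qed

lemma to_fract_sum: "to_fract (sum f I) = (\<Sum>i\<in>I. to_fract (f i))"
  by (induction I rule: infinite_finite_induct) auto

theorem theorem3:
  fixes \<iota> :: "'k::field_char_0 \<Rightarrow> 'l::field_char_0"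
    and a :: "nat \<Rightarrow> 'l"
  assumes "finite_extension \<iota>"
    and "rational_seq a"
  shows "virtually_periodic (\<lambda>n. ext_degree \<iota> (a n)) \<and>
         rational_seq (\<lambda>n. to_fract (min_poly \<iota> (a n))) \<and>
         (\<forall>z \<in> gen_fun_poles (\<lambda>n. to_fract (min_poly \<iota> (a n))).
            algebraic_over const_to_ac z)"
proof -
  note fin = assms(1)
  define E where "E = ac_embeddings \<iota>"
  have finE: "finite E" unfolding E_def by (rule finite_embeddings[OF fin])
  have homE: "hom_on UNIV s" if "s \<in> E" for s
    using that embedding_hom[OF fin] by (simp add: E_def)
  have conj_rec: "lin_rec UNIV (\<lambda>n. s (a n))" if "s \<in> E" for s
    using lin_rec_mono[OF subset_UNIV lin_rec_hom[OF rational_seq_imp_lin_rec[OF assms(2)] homE[OF that]]] .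

  \<comment> \<open>Skolem--Mahler--Lech applies to each difference of two conjugates; since the
    pairs are finitely many, a common N and r follow.\<close>
  have "virtually_periodic (\<lambda>n. fst st (a n) = snd st (a n))" if "st \<in> E \<times> E" for st
  proof -
    have "virtually_periodic (\<lambda>n. fst st (a n) - snd st (a n) = 0)"
      using that by (intro skolem_mahler_lech lin_rec_diff[OF is_subfield_UNIV] conj_rec) auto
    then show ?thesis by simp
  qed
  then have "\<exists>N r. r > 0 \<and> (\<forall>st\<in>E \<times> E. \<forall>n>N.
      (fst st (a (n + r)) = snd st (a (n + r))) = (fst st (a n) = snd st (a n)))"
    by (intro virtually_periodic_family) (use finE in auto)
  then obtain N r where r: "r > 0" "\<forall>st\<in>E \<times> E. \<forall>n>N.
      (fst st (a (n + r)) = snd st (a (n + r))) = (fst st (a n) = snd st (a n))" by blast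
  have per: "(s (a (n + r * k)) = t (a (n + r * k))) = (s (a n) = t (a n))"
    if "s \<in> E" "t \<in> E" "n > N" for s t n k
    using periodic_multiple[of N "\<lambda>n. s (a n) = t (a n)" r n k]
      bspec[OF r(2), of "(s, t)"] that by simp

  \<comment> \<open>A standard index in the residue class of n that depends on n mod r only; the
    summand r * (N + 1) keeps it above N even for residue 0.\<close>
  define base where "base = (\<lambda>n. n mod r + r * Suc N)"
  have base_gt: "base n > N" for n
  proof -
    have "N < 1 * Suc N" by simp
    also have "\<dots> \<le> r * Suc N" by (rule mult_le_mono1) (use r(1) in simp)
    also have "\<dots> \<le> base n" unfolding base_def by (rule le_add2)
    finally show ?thesis .
  qed
  have base: "(s (a (base n)) = t (a (base n))) = (s (a n) = t (a n))"
    if "s \<in> E" "t \<in> E" "n > N" for s t n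
  proof -
    \<comment> \<open>Either index may be the smaller one, so both are moved forward to a common
      index.\<close>
    have "base n + r * (n div r) = n + r * Suc N" by (simp add: base_def)
    then show ?thesis using per[OF that, of "Suc N"] per[OF that(1,2) base_gt[of n], of "n div r"] by simp
  qed
  define v where "v = (\<lambda>n (s :: 'l \<Rightarrow> 'k alg_closure). s (a n))"
  have "\<forall>n. \<exists>R. R \<subseteq> E \<and> inj_on (v n) R \<and> v n ` R = v n ` E"
    by (intro allI ex_inj_on_subset_same_image)
  from choice[OF this] obtain R0
    where "\<forall>n. R0 n \<subseteq> E \<and> inj_on (v n) (R0 n) \<and> v n ` R0 n = v n ` E" ..
  then have R0: "R0 n \<subseteq> E" "inj_on (v n) (R0 n)" "v n ` R0 n = v n ` E" for n
    by iprover+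
  \<comment> \<open>Embeddings that represent the distinct conjugates, chosen once per residue class
    at its standard index; periodicity makes them valid at every n > N of the class.\<close>
  define R where "R = (\<lambda>j. R0 (base j))"
  have base_mod: "base (n mod r) = base n" for n by (simp add: base_def)
  have R: "inj_on (v n) (R (n mod r))" "v n ` R (n mod r) = v n ` E" if "n > N" for n
    unfolding R_def base_mod
    by (rule same_fibres_transfer[OF R0[of "base n"]], unfold v_def, rule base[OF _ _ that], assumption+)+

  have "virtually_periodic (\<lambda>n. ext_degree \<iota> (a n))"
    unfolding virtually_periodic_def
  proof (intro exI conjI allI impI)
    fix n assume n: "n > N"
    have deg: "ext_degree \<iota> (a n) = card (R (n mod r))" if "n > N" for n
    proof -
      have "ext_degree \<iota> (a n) = card (v n ` E)"
        by (simp add: ext_degree_eq_degree_min_poly[OF fin] degree_min_poly_eq_card[OF fin] E_def v_def)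
      also have "\<dots> = card (R (n mod r))"
        unfolding R(2)[OF that, symmetric] by (rule card_image[OF R(1)[OF that]])
      finally show ?thesis .
    qed
    show "ext_degree \<iota> (a (n + r)) = ext_degree \<iota> (a n)"
      using deg[of n] deg[of "n + r"] n by simp
  qed (rule r(1))

  moreover
  \<comment> \<open>The copy of K inside K(T).\<close>
  define C where "C = range (\<lambda>c::'k. to_fract [:c:])"
  have C: "is_subfield C" unfolding C_def by (rule is_subfield_range[OF hom_on_const_to_fract])
  have coeff_rec: "lin_rec C (\<lambda>n. to_fract [:coeff (min_poly \<iota> (a n)) k:])" for k
  proof -
    have "lin_rec UNIV (\<lambda>n. to_ac (coeff (min_poly \<iota> (a n)) k))"
    \<comment> \<open>On a residue class the product over distinct conjugates gets the fixed index
      set R j.\<close>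
    proof (rule lin_rec_residue_classes[OF is_subfield_UNIV r(1)])
      show "lin_rec UNIV (\<lambda>n. coeff (\<Prod>s\<in>R j. [:- s (a n), 1:]) k)" for j
        using R0(1) finE by (intro lin_rec_coeff_prod conj_rec) (auto simp: R_def intro: finite_subset)
      fix n assume n: "n > N"
      have "map_poly to_ac (min_poly \<iota> (a n)) = (\<Prod>z\<in>v n ` E. [:- z, 1:])"
        unfolding E_def v_def by (rule min_poly_eq_prod_conjugates[OF fin])
      also have "\<dots> = (\<Prod>s\<in>R (n mod r). [:- s (a n), 1:])"
        unfolding R(2)[OF n, symmetric] by (subst prod.reindex[OF R(1)[OF n]]) (simp add: v_def)
      finally show "to_ac (coeff (min_poly \<iota> (a n)) k) = coeff (\<Prod>s\<in>R (n mod r). [:- s (a n), 1:]) k"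
        by (simp flip: coeff_map_poly[of to_ac, OF to_ac_0])
    qed
    then have "lin_rec UNIV (\<lambda>n. coeff (min_poly \<iota> (a n)) k)" by (rule lin_rec_of_to_ac)
    from lin_rec_hom[OF this hom_on_const_to_fract] show ?thesis unfolding C_def .
  qed
  \<comment> \<open>card E bounds all degrees at once, so the sum has a fixed length; T^k enters as
    a scalar and leaves the coefficients of the recurrence in C.\<close>
  have expand: "to_fract (min_poly \<iota> (a n)) =
      (\<Sum>k\<le>card E. to_fract (monom 1 k) * to_fract [:coeff (min_poly \<iota> (a n)) k:])" for n
  proof -
    have "degree (min_poly \<iota> (a n)) \<le> card E"
      unfolding degree_min_poly_eq_card[OF fin] E_def[symmetric] by (rule card_image_le[OF finE])
    then have "min_poly \<iota> (a n) = (\<Sum>k\<le>card E. monom (coeff (min_poly \<iota> (a n)) k) k)"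
      by (rule poly_as_sum_of_monoms'[symmetric])
    also have "\<dots> = (\<Sum>k\<le>card E. monom 1 k * [:coeff (min_poly \<iota> (a n)) k:])"
      by (simp add: smult_monom)
    finally have "to_fract (min_poly \<iota> (a n)) =
        to_fract (\<Sum>k\<le>card E. monom 1 k * [:coeff (min_poly \<iota> (a n)) k:])" by (rule arg_cong)
    then show ?thesis by (simp only: to_fract_sum to_fract_mult)
  qed
  have "lin_rec C (\<lambda>n. to_fract (min_poly \<iota> (a n)))"
    unfolding expand by (intro lin_rec_sum[OF C] lin_rec_scale coeff_rec)
  then obtain p q where q: "q \<in> poly_over C" and pq: "gen_fun_eq (\<lambda>n. to_fract (min_poly \<iota> (a n))) p q"
    by (rule lin_rec_imp_gen_fun[OF is_subfield_imp_subring[OF C]])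
  have "rational_seq (\<lambda>n. to_fract (min_poly \<iota> (a n)))"
    unfolding rational_seq_def using pq by blast
  moreover have "algebraic_over const_to_ac z"
    if z: "z \<in> gen_fun_poles (\<lambda>n. to_fract (min_poly \<iota> (a n)))" for z
  proof -
    \<comment> \<open>The denominator q comes from a polynomial over K, which annihilates every
      pole.\<close>
    obtain q' where q': "q = map_poly (\<lambda>c. to_fract [:c:]) q'"
      using poly_over_range[OF hom_on_const_to_fract q[unfolded C_def]] .
    have "map_poly to_ac q = map_poly const_to_ac q'"
      by (rule poly_eqI) (simp add: q' coeff_map_poly const_to_ac_def)
    moreover have "q' \<noteq> 0" using pq q' by (auto simp: gen_fun_eq_def)
    ultimately show ?thesis
      unfolding algebraic_over_def using gen_fun_pole_root[OF z pq] by metis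
  qed
  ultimately show ?thesis by blast
qed

end
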